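(* Every GDW-metric (generalized Douglas-Weyl Finsler metric) is a W-GDW-metric (weakly generalized Douglas-Weyl Finsler metric).
   Context: Let $M$ be an $n$-dimensional smooth manifold. A Finsler metric on $M$ is a non-negative function $F$ on $TM$ that is $C^\infty$ on $TM_0=TM\setminus\{0\}$, positively homogeneous of degree one in $y$, and such that $g_{ij}=\frac12\frac{\partial^2F^2}{\partial y^i\partial y^j}$ is positive definite at every $y\neq 0$. Its spray coefficients are $G^i(x,y)=\frac14 g^{il}\left\{\frac{\partial^2F^2}{\partial x^k\partial y^l}y^k-\frac{\partial F^2}{\partial x^l}\right\}$. Notation: "$._k$" denotes $\partial/\partial y^k$ (vertical derivative); "$|_m$" denotes the horizontal covariant derivative with respect to the Berwald connection of $F$, e.g. $T^i{}_{j|m}=\frac{\partial T^i{}_j}{\partial x^m}-G^r{}_{.m}T^i{}_{j.r}+T^r{}_jG^i{}_{.r.m}-T^i{}_rG^r{}_{.j.m}$, and similarly for other tensors on $TM_0$. A subscript $0$ denotes contraction with $y$: $T_{|0}=T_{|m}y^m$. The Douglas tensor is $D_j{}^i{}_{kl}=\frac{\partial^3}{\partial y^j\partial y^k\partial y^l}\left(G^i-\frac1{n+1}\frac{\partial G^m}{\partial y^m}y^i\right)$. Put $\tilde D_j{}^i{}_{kl}=D_j{}^i{}_{kl|0}$. $F$ is a GDW-metric if $D_j{}^i{}_{kl|0}=T_{jkl}y^i$ for the coefficients $T_{jkl}$ of some tensor. $F$ is a W-GDW-metric if there are a scalar function $\lambda=\lambda(x,y)$ on $TM$ and coefficients $U_{jkl}$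 of some tensor field such that $\tilde D_j{}^i{}_{kl|0}+\lambda F\tilde D_j{}^i{}_{kl}=U_{jkl}y^i$. *)

theory Defs
  imports "HOL-Analysis.Analysis"
begin

section \<open>Smooth functions\<close>

text \<open>Only used on open sets \<open>S\<close>, where \<open>frechet_derivative f (at x)\<close> depends on the values
  of \<open>f\<close> on \<open>S\<close> only.\<close>

fun Ck_on :: "nat \<Rightarrow> 'a::real_normed_vector set \<Rightarrow> ('a \<Rightarrow> 'b::real_normed_vector) \<Rightarrow> bool" where
  "Ck_on 0 S f \<longleftrightarrow> continuous_on S f"
| "Ck_on (Suc k) S f \<longleftrightarrow> (\<forall>x\<in>S. f differentiable (at x)) \<and>
     (\<forall>v. Ck_on k S (\<lambda>x. frechet_derivative f (at x) v))"

definition smooth_on :: "'a::real_normed_vector set \<Rightarrow> ('a \<Rightarrow> 'b::real_normed_vector) \<Rightarrow> bool" where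
  "smooth_on S f \<longleftrightarrow> (\<forall>k. Ck_on k S f)"


section \<open>Smooth manifolds and tangent vectors\<close>

text \<open>A manifold is a Hausdorff, second countable type \<open>'m\<close> with a (not necessarily maximal)
  smooth atlas. A chart is a pair of its domain and its coordinate map, whose values outside the
  domain are irrelevant.\<close>

type_synonym ('m, 'e) chart = "'m set \<times> ('m \<Rightarrow> 'e)"

definition is_chart :: "('m::topological_space, real^'n) chart \<Rightarrow> bool" where
  "is_chart c \<longleftrightarrow> open (fst c) \<and> open (snd c ` fst c) \<and>
     (\<exists>\<psi>. homeomorphism (fst c) (snd c ` fst c) (snd c) \<psi>)"

definition chart_inv :: "('m, real^'n) chart \<Rightarrow> real^'n \<Rightarrow> 'm" where
  "chart_inv c = inv_into (fst c) (snd c)"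

definition transition ::
  "('m, real^'n) chart \<Rightarrow> ('m, real^'n) chart \<Rightarrow> real^'n \<Rightarrow> real^'n" where
  "transition c c' = snd c' \<circ> chart_inv c"

definition transition_dom :: "('m, real^'n) chart \<Rightarrow> ('m, real^'n) chart \<Rightarrow> (real^'n) set" where
  "transition_dom c c' = snd c ` (fst c \<inter> fst c')"

definition smooth_atlas ::
  "('m::{t2_space, second_countable_topology}, real^'n) chart set \<Rightarrow> bool" where
  "smooth_atlas A \<longleftrightarrow> (\<forall>c\<in>A. is_chart c) \<and> (\<Union>c\<in>A. fst c) = UNIV \<and>
     (\<forall>c\<in>A. \<forall>c'\<in>A. smooth_on (transition_dom c c') (transition c c'))"

definition transition_jac ::
  "('m, real^'n) chart \<Rightarrow> ('m, real^'n) chart \<Rightarrow> real^'n \<Rightarrow> real^'n^'n" where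
  "transition_jac c c' x = matrix (frechet_derivative (transition c c') (at x))"

text \<open>A tangent vector at \<open>p\<close> is a family of component vectors, one for each chart around \<open>p\<close>,
  related by the Jacobians of the coordinate changes; it is \<open>0\<close> at all other indices.\<close>

type_synonym ('m, 'e) tangent_vector = "('m, 'e) chart \<Rightarrow> 'e"

definition tangent_space ::
  "('m, real^'n) chart set \<Rightarrow> 'm \<Rightarrow> ('m, real^'n) tangent_vector set" where
  "tangent_space A p = {v.
     (\<forall>c\<in>A. \<forall>c'\<in>A. p \<in> fst c \<longrightarrow> p \<in> fst c' \<longrightarrow> v c' = transition_jac c c' (snd c p) *v v c) \<and>
     (\<forall>c. \<not> (c \<in> A \<and> p \<in> fst c) \<longrightarrow> v c = 0)}"

definition tangent_bundle ::
  "('m, real^'n) chart set \<Rightarrow> ('m \<times> ('m, real^'n) tangent_vector) set" where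
  "tangent_bundle A = (SIGMA p:UNIV. tangent_space A p)"

text \<open>The unique point \<open>(p, v)\<close> of the tangent bundle such that \<open>p\<close> has coordinates \<open>x\<close> and \<open>v\<close> has
  components \<open>y\<close> in the chart \<open>c\<close>.\<close>

definition tangent_point ::
  "('m, real^'n) chart set \<Rightarrow> ('m, real^'n) chart \<Rightarrow> real^'n \<Rightarrow> real^'n \<Rightarrow>
     'm \<times> ('m, real^'n) tangent_vector" where
  "tangent_point A c x y = (chart_inv c x,
     \<lambda>c'. if c' \<in> A \<and> chart_inv c x \<in> fst c' then transition_jac c c' x *v y else 0)"

text \<open>Local coordinate expressions of functions on the tangent bundle.\<close>

type_synonym 'n local_fun = "real^'n \<Rightarrow> real^'n \<Rightarrow> real"

definition local_rep ::
  "('m, real^'n) chart set \<Rightarrow> ('m \<times> ('m, real^'n) tangent_vector \<Rightarrow> real) \<Rightarrow>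
     ('m, real^'n) chart \<Rightarrow> 'n local_fun" where
  "local_rep A f c = (\<lambda>x y. f (tangent_point A c x y))"

text \<open>The range of the coordinates \<open>(x, y)\<close> of the slit tangent bundle.\<close>

definition slit_dom :: "('m, real^'n) chart \<Rightarrow> ((real^'n) \<times> (real^'n)) set" where
  "slit_dom c = (snd c ` fst c) \<times> (UNIV - {0})"

definition smooth_scalar ::
  "('m, real^'n) chart set \<Rightarrow> ('m \<times> ('m, real^'n) tangent_vector \<Rightarrow> real) \<Rightarrow> bool" where
  "smooth_scalar A f \<longleftrightarrow> (\<forall>c\<in>A. smooth_on (slit_dom c) (\<lambda>(x, y). local_rep A f c x y))"

text \<open>Covariant tensor fields of rank three on the slit tangent bundle, given by their coefficients
  in the charts. As usual in Finsler geometry, the coefficients are functions of \<open>(x, y)\<close> that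
  transform with the Jacobian of the change of the base coordinates only.\<close>

definition tensor_field3 ::
  "('m, real^'n) chart set \<Rightarrow> (('m, real^'n) chart \<Rightarrow> 'n \<Rightarrow> 'n \<Rightarrow> 'n \<Rightarrow> 'n local_fun) \<Rightarrow> bool" where
  "tensor_field3 A T \<longleftrightarrow>
     (\<forall>c\<in>A. \<forall>j k l. smooth_on (slit_dom c) (\<lambda>(x, y). T c j k l x y)) \<and>
     (\<forall>c\<in>A. \<forall>c'\<in>A. \<forall>x\<in>transition_dom c c'. \<forall>y. y \<noteq> 0 \<longrightarrow>
        (let J = transition_jac c c' x in \<forall>j k l.
          T c j k l x y =
            (\<Sum>p\<in>UNIV. \<Sum>q\<in>UNIV. \<Sum>r\<in>UNIV.
               T c' p q r (transition c c' x) (J *v y) * J$p$j * J$q$k * J$r$l)))"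


section \<open>Finsler metrics\<close>

definition dx :: "'n \<Rightarrow> 'n local_fun \<Rightarrow> 'n::finite local_fun" where
  "dx k f = (\<lambda>x y. deriv (\<lambda>t. f (x + t *\<^sub>R axis k 1) y) 0)"

definition dy :: "'n \<Rightarrow> 'n local_fun \<Rightarrow> 'n::finite local_fun" where
  "dy k f = (\<lambda>x y. deriv (\<lambda>t. f x (y + t *\<^sub>R axis k 1)) 0)"

definition energy ::
  "('m, real^'n) chart set \<Rightarrow> ('m \<times> ('m, real^'n) tangent_vector \<Rightarrow> real) \<Rightarrow>
     ('m, real^'n) chart \<Rightarrow> 'n local_fun" where
  "energy A F c = (\<lambda>x y. (local_rep A F c x y)\<^sup>2)"

definition fund_tensor ::
  "('m, real^'n) chart set \<Rightarrow> ('m \<times> ('m, real^'n) tangent_vector \<Rightarrow> real) \<Rightarrow>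
     ('m, real^'n) chart \<Rightarrow> real^'n \<Rightarrow> real^'n \<Rightarrow> real^'n^'n" where
  "fund_tensor A F c x y = (\<chi> i j. 1/2 * dy i (dy j (energy A F c)) x y)"

definition finsler_metric ::
  "('m, real^'n) chart set \<Rightarrow> ('m \<times> ('m, real^'n) tangent_vector \<Rightarrow> real) \<Rightarrow> bool" where
  "finsler_metric A F \<longleftrightarrow>
     (\<forall>w\<in>tangent_bundle A. F w \<ge> 0) \<and>
     smooth_scalar A F \<and>
     (\<forall>(p, v)\<in>tangent_bundle A. \<forall>t>0. F (p, \<lambda>c. t *\<^sub>R v c) = t * F (p, v)) \<and>
     (\<forall>c\<in>A. \<forall>(x, y)\<in>slit_dom c. \<forall>v. v \<noteq> 0 \<longrightarrow> v \<bullet> (fund_tensor A F c x y *v v) > 0)"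

definition spray ::
  "('m, real^'n) chart set \<Rightarrow> ('m \<times> ('m, real^'n) tangent_vector \<Rightarrow> real) \<Rightarrow>
     ('m, real^'n) chart \<Rightarrow> 'n \<Rightarrow> 'n local_fun" where
  "spray A F c i = (\<lambda>x y. 1/4 * (\<Sum>l\<in>UNIV. matrix_inv (fund_tensor A F c x y) $ i $ l *
     ((\<Sum>k\<in>UNIV. dx k (dy l (energy A F c)) x y * y$k) - dx l (energy A F c) x y)))"

text \<open>In \<open>T j i k l\<close> the index \<open>i\<close> is contravariant, \<open>j\<close>, \<open>k\<close>, \<open>l\<close> are covariant.\<close>

definition douglas ::
  "('m, real^'n) chart set \<Rightarrow> ('m \<times> ('m, real^'n) tangent_vector \<Rightarrow> real) \<Rightarrow>
     ('m, real^'n) chart \<Rightarrow> 'n \<Rightarrow> 'n \<Rightarrow> 'n \<Rightarrow> 'n \<Rightarrow> 'n local_fun" where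
  "douglas A F c j i k l = dy j (dy k (dy l (\<lambda>x y.
     spray A F c i x y -
       1 / (real CARD('n) + 1) * (\<Sum>m\<in>UNIV. dy m (spray A F c m) x y) * y$i)))"

text \<open>Horizontal Berwald derivative \<open>T\<^bsub>|m\<^esub>\<close> for the spray coefficients \<open>G\<close>.\<close>

definition berwald_deriv ::
  "('n \<Rightarrow> 'n local_fun) \<Rightarrow> ('n \<Rightarrow> 'n \<Rightarrow> 'n \<Rightarrow> 'n \<Rightarrow> 'n local_fun) \<Rightarrow>
     'n::finite \<Rightarrow> 'n \<Rightarrow> 'n \<Rightarrow> 'n \<Rightarrow> 'n \<Rightarrow> 'n local_fun" where
  "berwald_deriv G T m j i k l = (\<lambda>x y.
     dx m (T j i k l) x y
     - (\<Sum>r\<in>UNIV. dy m (G r) x y * dy r (T j i k l) x y)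
     + (\<Sum>r\<in>UNIV. T j r k l x y * dy m (dy r (G i)) x y)
     - (\<Sum>r\<in>UNIV. T r i k l x y * dy m (dy j (G r)) x y)
     - (\<Sum>r\<in>UNIV. T j i r l x y * dy m (dy k (G r)) x y)
     - (\<Sum>r\<in>UNIV. T j i k r x y * dy m (dy l (G r)) x y))"

definition berwald_deriv0 ::
  "('n \<Rightarrow> 'n local_fun) \<Rightarrow> ('n \<Rightarrow> 'n \<Rightarrow> 'n \<Rightarrow> 'n \<Rightarrow> 'n local_fun) \<Rightarrow>
     'n::finite \<Rightarrow> 'n \<Rightarrow> 'n \<Rightarrow> 'n \<Rightarrow> 'n local_fun" where
  "berwald_deriv0 G T j i k l = (\<lambda>x y. \<Sum>m\<in>UNIV. berwald_deriv G T m j i k l x y * y$m)"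

definition douglas_deriv0 ::
  "('m, real^'n) chart set \<Rightarrow> ('m \<times> ('m, real^'n) tangent_vector \<Rightarrow> real) \<Rightarrow>
     ('m, real^'n) chart \<Rightarrow> 'n \<Rightarrow> 'n \<Rightarrow> 'n \<Rightarrow> 'n \<Rightarrow> 'n local_fun" where
  "douglas_deriv0 A F c = berwald_deriv0 (spray A F c) (douglas A F c)"

definition GDW_metric ::
  "('m, real^'n) chart set \<Rightarrow> ('m \<times> ('m, real^'n) tangent_vector \<Rightarrow> real) \<Rightarrow> bool" where
  "GDW_metric A F \<longleftrightarrow> finsler_metric A F \<and>
     (\<exists>T. tensor_field3 A T \<and>
       (\<forall>c\<in>A. \<forall>(x, y)\<in>slit_dom c. \<forall>j i k l.
          douglas_deriv0 A F c j i k l x y = T c j k l x y * y$i))"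

definition W_GDW_metric ::
  "('m, real^'n) chart set \<Rightarrow> ('m \<times> ('m, real^'n) tangent_vector \<Rightarrow> real) \<Rightarrow> bool" where
  "W_GDW_metric A F \<longleftrightarrow> finsler_metric A F \<and>
     (\<exists>lam U. smooth_scalar A lam \<and> tensor_field3 A U \<and>
       (\<forall>c\<in>A. \<forall>(x, y)\<in>slit_dom c. \<forall>j i k l.
          berwald_deriv0 (spray A F c) (douglas_deriv0 A F c) j i k l x y
            + local_rep A lam c x y * local_rep A F c x y * douglas_deriv0 A F c j i k l x y
          = U c j k l x y * y$i))"

end

theory Submission
  imports Defs
begin

text \<open>Take \<open>\<lambda> = 0\<close>. If \<open>D\<^bsub>j\<^esub>\<^sup>i\<^bsub>kl|0\<^esub> = T\<^bsub>jkl\<^esub> y\<^sup>i\<close>, then applying \<open>|0\<close> once more gives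
  \<open>T\<^bsub>jkl|0\<^esub> y\<^sup>i\<close>, because \<open>y\<^sup>i\<^bsub>|0\<^esub> = 0\<close> by Euler's theorem for the spray coefficients, which are
  homogeneous of degree two. The point to check is that \<open>T\<^bsub>jkl|0\<^esub>\<close> is again a tensor field. In
  coordinates \<open>T\<^bsub>jkl|0\<^esub>\<close> is the derivative of \<open>T\<^bsub>jkl\<^esub>\<close> along \<open>(y, -2G)\<close> minus the contractions of \<open>T\<close> with
  \<open>N\<^sup>r\<^bsub>j\<^esub> = \<partial>G\<^sup>r/\<partial>y\<^sup>j\<close>. Under a coordinate change \<open>\<phi>\<close> with Jacobian \<open>J\<close>, the Euler-Lagrange equations, which
  characterize \<open>G\<close>, yield \<open>-2G'(\<phi>(x), Jy) = D\<^sup>2\<phi>(y, y) - 2JG(x, y)\<close>, and differentiating in \<open>y\<close> gives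
  \<open>D\<^sup>2\<phi>(y, b) = JNb - N'Jb\<close>; this cancels the second derivatives of \<open>\<phi>\<close> that arise from
  differentiating the Jacobians in the transformation law of \<open>T\<close>.\<close>

section \<open>Calculus of smooth functions\<close>

lemma Ck_on_cong:
  assumes "open S" "\<And>x. x \<in> S \<Longrightarrow> f x = g x" "Ck_on k S f"
  shows "Ck_on k S g"
  using assms(2,3)
proof (induction k arbitrary: f g)
  case 0
  then show ?case using continuous_on_cong by (metis Ck_on.simps(1))
next
  case (Suc k)
  have d: "(g has_derivative frechet_derivative f (at x)) (at x)" if "x \<in> S" for x
    using that Suc.prems assms(1)
    by (auto simp: frechet_derivative_works intro: has_derivative_transform_within_open[OF _ assms(1)])
  have e: "frechet_derivative g (at x) = frechet_derivative f (at x)" if "x \<in> S" for x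
    using frechet_derivative_at[OF d[OF that]] by simp
  show ?case
    using Suc.IH[of "\<lambda>x. frechet_derivative f (at x) v" "\<lambda>x. frechet_derivative g (at x) v" for v]
      Suc.prems(2) d by (auto simp: e Suc.prems(1) intro: differentiableI)
qed

lemma Ck_on_Suc_imp: "Ck_on (Suc k) S f \<Longrightarrow> Ck_on k S f"
proof (induction k arbitrary: f)
  case 0
  then show ?case
    by (auto intro!: continuous_at_imp_continuous_on differentiable_imp_continuous_within)
next
  case (Suc k)
  show ?case
    using Suc.IH[of "\<lambda>x. frechet_derivative f (at x) v" for v] Suc.prems
    by (simp only: Ck_on.simps(2)) blast
qed

lemma Ck_on_Suc_has_derivative:
  "Ck_on (Suc k) S f \<Longrightarrow> x \<in> S \<Longrightarrow> (f has_derivative frechet_derivative f (at x)) (at x)"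
  by (simp add: frechet_derivative_works)

text \<open>Replaces \<open>frechet_derivative\<close> by an explicit derivative formula, so that
  the inductions over the order for sums, products and inverses can use the usual differentiation
  rules.\<close>

lemma Ck_on_SucI:
  assumes "open S" "\<And>x. x \<in> S \<Longrightarrow> (f has_derivative f' x) (at x)"
    "\<And>v. Ck_on k S (\<lambda>x. f' x v)"
  shows "Ck_on (Suc k) S f"
proof -
  have "frechet_derivative f (at x) = f' x" if "x \<in> S" for x
    using frechet_derivative_at[OF assms(2)[OF that]] by simp
  then have "Ck_on k S (\<lambda>x. frechet_derivative f (at x) v)" for v
    by (intro Ck_on_cong[OF assms(1) _ assms(3)[of v]]) simp
  then show ?thesis
    using assms(2) by (auto simp: differentiable_def)
qed

lemma Ck_on_const: "Ck_on k S (\<lambda>x. c)"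
  by (induction k arbitrary: c) auto

lemma Ck_on_bounded_linear:
  assumes "bounded_linear f" shows "Ck_on k S f"
proof (cases k)
  case 0
  then show ?thesis using assms by (simp add: linear_continuous_on)
next
  case (Suc j)
  have "frechet_derivative f (at x) = f" for x
    using frechet_derivative_at[OF bounded_linear_imp_has_derivative[OF assms]] by simp
  then show ?thesis using assms Suc
    by (simp add: Ck_on_const bounded_linear_imp_differentiable)
qed

lemma Ck_on_add:
  assumes "open S" "Ck_on k S f" "Ck_on k S g"
  shows "Ck_on k S (\<lambda>x. f x + g x)"
  using assms(2,3)
proof (induction k arbitrary: f g)
  case (Suc k)
  show ?case
    by (rule Ck_on_SucI[OF assms(1) has_derivative_add[OF
          Ck_on_Suc_has_derivative[OF Suc.prems(1)] Ck_on_Suc_has_derivative[OF Suc.prems(2)]]])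
      (use Suc in auto)
qed (auto intro: continuous_intros)

lemma Ck_on_mult:
  fixes f g :: "'a::real_normed_vector \<Rightarrow> real"
  assumes "open S" "Ck_on k S f" "Ck_on k S g"
  shows "Ck_on k S (\<lambda>x. f x * g x)"
  using assms(2,3)
proof (induction k arbitrary: f g)
  case (Suc k)
  have "Ck_on k S f" "Ck_on k S g"
    using Suc.prems Ck_on_Suc_imp by blast+
  then show ?case
    by (intro Ck_on_SucI[OF assms(1) has_derivative_mult[OF
          Ck_on_Suc_has_derivative[OF Suc.prems(1)] Ck_on_Suc_has_derivative[OF Suc.prems(2)]]]
        Ck_on_add[OF assms(1)] Suc.IH) (use Suc.prems in auto)
qed (auto intro: continuous_intros)

text \<open>The derivative of 1/f is -(1/f) f' (1/f), so at each order the induction hypothesis for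
  1/f itself, together with closure under products, controls the derivative.\<close>

lemma Ck_on_inverse:
  fixes f :: "'a::real_normed_vector \<Rightarrow> real"
  assumes "open S" "\<And>x. x \<in> S \<Longrightarrow> f x \<noteq> 0" "Ck_on k S f"
  shows "Ck_on k S (\<lambda>x. inverse (f x))"
  using assms(3)
proof (induction k)
  case (Suc k)
  have f: "Ck_on k S f"
    using Suc.prems Ck_on_Suc_imp by blast
  have d: "((\<lambda>x. inverse (f x)) has_derivative
      (\<lambda>h. - 1 * (inverse (f x) * frechet_derivative f (at x) h * inverse (f x)))) (at x)" if "x \<in> S" for x
    using Deriv.has_derivative_inverse[OF assms(2)[OF that] Ck_on_Suc_has_derivative[OF Suc.prems that]]
    by simp
  show ?case
    by (intro Ck_on_SucI[OF assms(1) d] Ck_on_mult assms(1) Ck_on_const Suc.IH f)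
      (use Suc.prems in auto)
qed (use assms(2) in \<open>auto intro: continuous_intros\<close>)

lemma smooth_on_cong:
  "open S \<Longrightarrow> (\<And>x. x \<in> S \<Longrightarrow> f x = g x) \<Longrightarrow> smooth_on S f \<Longrightarrow> smooth_on S g"
  unfolding smooth_on_def using Ck_on_cong by blast

lemma smooth_on_const: "smooth_on S (\<lambda>x. c)"
  by (simp add: smooth_on_def Ck_on_const)

lemma smooth_on_bounded_linear: "bounded_linear f \<Longrightarrow> smooth_on S f"
  by (simp add: smooth_on_def Ck_on_bounded_linear)

lemma smooth_on_add: "open S \<Longrightarrow> smooth_on S f \<Longrightarrow> smooth_on S g \<Longrightarrow> smooth_on S (\<lambda>x. f x + g x)"
  by (simp add: smooth_on_def Ck_on_add)

lemma smooth_on_mult: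
  fixes f g :: "'a::real_normed_vector \<Rightarrow> real"
  shows "open S \<Longrightarrow> smooth_on S f \<Longrightarrow> smooth_on S g \<Longrightarrow> smooth_on S (\<lambda>x. f x * g x)"
  by (simp add: smooth_on_def Ck_on_mult)

lemma smooth_on_minus:
  fixes f g :: "'a::real_normed_vector \<Rightarrow> real"
  assumes "open S" "smooth_on S f" "smooth_on S g"
  shows "smooth_on S (\<lambda>x. f x - g x)"
  using smooth_on_add[OF assms(1,2) smooth_on_mult[OF assms(1) smooth_on_const[where c="-1"] assms(3)]]
  by simp

lemma smooth_on_sum:
  assumes "open S" "\<And>i. i \<in> I \<Longrightarrow> smooth_on S (f i)"
  shows "smooth_on S (\<lambda>x. \<Sum>i\<in>I. f i x)"
  using assms(2)
  by (induction I rule: infinite_finite_induct)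
    (auto intro: smooth_on_add smooth_on_const assms(1))

lemma smooth_on_prod:
  fixes f :: "'i \<Rightarrow> 'a::real_normed_vector \<Rightarrow> real"
  assumes "open S" "\<And>i. i \<in> I \<Longrightarrow> smooth_on S (f i)"
  shows "smooth_on S (\<lambda>x. \<Prod>i\<in>I. f i x)"
  using assms(2)
  by (induction I rule: infinite_finite_induct)
    (auto intro: smooth_on_mult smooth_on_const assms(1))

lemma smooth_on_divide:
  fixes f g :: "'a::real_normed_vector \<Rightarrow> real"
  assumes "open S" "smooth_on S f" "smooth_on S g" "\<And>x. x \<in> S \<Longrightarrow> g x \<noteq> 0"
  shows "smooth_on S (\<lambda>x. f x / g x)"
  using assms by (simp add: divide_inverse smooth_on_def Ck_on_mult Ck_on_inverse)

lemma smooth_on_frechet_derivative: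
  "smooth_on S f \<Longrightarrow> smooth_on S (\<lambda>x. frechet_derivative f (at x) v)"
  unfolding smooth_on_def by (metis Ck_on.simps(2))

lemma smooth_on_has_derivative:
  "smooth_on S f \<Longrightarrow> x \<in> S \<Longrightarrow> (f has_derivative frechet_derivative f (at x)) (at x)"
  unfolding smooth_on_def using Ck_on_Suc_has_derivative by blast

lemma smooth_on_continuous_on: "smooth_on S f \<Longrightarrow> continuous_on S f"
  unfolding smooth_on_def by (metis Ck_on.simps(1))

text \<open>The Leibniz formula makes the determinant a polynomial in the entries. This serves the
  application of Cramer's rule to the spray.\<close>

lemma smooth_on_det:
  fixes M :: "'a::real_normed_vector \<Rightarrow> real^'n^'n"
  assumes "open S" "\<And>i j. smooth_on S (\<lambda>z. M z $ i $ j)"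
  shows "smooth_on S (\<lambda>z. det (M z))"
  unfolding det_def
  by (intro smooth_on_sum smooth_on_mult smooth_on_prod smooth_on_const assms)

section \<open>Symmetry of second derivatives\<close>

lemma has_real_derivative_along_line:
  assumes "(f has_derivative f') (at (x + t *\<^sub>R v))"
  shows "((\<lambda>s. f (x + s *\<^sub>R v)) has_real_derivative f' v) (at t)"
proof -
  have "((\<lambda>s. f (x + s *\<^sub>R v)) has_derivative (\<lambda>s. f' (s *\<^sub>R v))) (at t)"
    using assms by (auto intro!: derivative_eq_intros has_derivative_compose[of "\<lambda>s. x + s *\<^sub>R v" _ t UNIV f])
  then show ?thesis
    using linear_scale[OF has_derivative_linear[OF assms]]
    by (simp add: has_field_derivative_def mult_commute_abs)
qed

text \<open>The mean value theorem is applied twice, first along \<open>u\<close> and then along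
  \<open>v\<close>. The bound on \<open>t\<close> keeps the whole parallelogram spanned by
  \<open>t *\<^sub>R u\<close> and \<open>t *\<^sub>R v\<close> inside the ball.\<close>

lemma second_difference_mvt:
  fixes f :: "'a::real_normed_vector \<Rightarrow> real"
  assumes f: "smooth_on S f" and b: "ball x r \<subseteq> S" and t: "0 < t" "t * (norm u + norm v) < r"
  shows "\<exists>z\<in>ball x r. f (x + t *\<^sub>R u + t *\<^sub>R v) - f (x + t *\<^sub>R u) - f (x + t *\<^sub>R v) + f x
    = t\<^sup>2 * frechet_derivative (\<lambda>z. frechet_derivative f (at z) u) (at z) v"
proof -
  have in_ball: "x + a *\<^sub>R u + c *\<^sub>R v \<in> ball x r" if "0 \<le> a" "a \<le> t" "0 \<le> c" "c \<le> t" for a c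
  proof -
    have "norm (a *\<^sub>R u + c *\<^sub>R v) \<le> a * norm u + c * norm v"
      using that norm_triangle_ineq[of "a *\<^sub>R u" "c *\<^sub>R v"] by simp
    also have "\<dots> \<le> t * norm u + t * norm v"
      using that by (intro add_mono mult_right_mono) auto
    also have "\<dots> < r" using t by (simp add: algebra_simps)
    finally show ?thesis
      by (metis (no_types, lifting) add.assoc add_diff_cancel_left' dist_commute dist_norm mem_ball)
  qed
  have D1: "((\<lambda>a. f (x + a *\<^sub>R u + c *\<^sub>R v)) has_real_derivative
      frechet_derivative f (at (x + a *\<^sub>R u + c *\<^sub>R v)) u) (at a)"
    if "0 \<le> a" "a \<le> t" "0 \<le> c" "c \<le> t" for a c
  proof -
    have "(f has_derivative frechet_derivative f (at (x + a *\<^sub>R u + c *\<^sub>R v))) (at (x + a *\<^sub>R u + c *\<^sub>R v))"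
      using smooth_on_has_derivative[OF f] in_ball[OF that] b by blast
    then show ?thesis
      using has_real_derivative_along_line[of f _ "x + c *\<^sub>R v" a u] by (simp add: ac_simps)
  qed
  let ?g = "\<lambda>z. frechet_derivative f (at z) u"
  have D2: "((\<lambda>c. ?g (x + a *\<^sub>R u + c *\<^sub>R v)) has_real_derivative
      frechet_derivative ?g (at (x + a *\<^sub>R u + c *\<^sub>R v)) v) (at c)"
    if "0 \<le> a" "a \<le> t" "0 \<le> c" "c \<le> t" for a c
  proof -
    have "(?g has_derivative frechet_derivative ?g (at (x + a *\<^sub>R u + c *\<^sub>R v))) (at (x + a *\<^sub>R u + c *\<^sub>R v))"
      using smooth_on_has_derivative[OF smooth_on_frechet_derivative[OF f]] in_ball[OF that] b by blast
    then show ?thesis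
      by (rule has_real_derivative_along_line)
  qed
  \<comment> \<open>The increment along \<open>v\<close> as a function of the parameter along
    \<open>u\<close>; the term \<open>0 *\<^sub>R v\<close> is kept so that \<open>D1\<close>
    applies to both summands.\<close>
  let ?h = "\<lambda>a. f (x + a *\<^sub>R u + t *\<^sub>R v) - f (x + a *\<^sub>R u + 0 *\<^sub>R v)"
  have "\<exists>a. 0 < a \<and> a < t \<and> ?h t - ?h 0 = (t - 0) * (?g (x + a *\<^sub>R u + t *\<^sub>R v) - ?g (x + a *\<^sub>R u + 0 *\<^sub>R v))"
    using t by (intro MVT2 DERIV_diff D1) auto
  then obtain a where a: "0 < a" "a < t"
    "?h t - ?h 0 = t * (?g (x + a *\<^sub>R u + t *\<^sub>R v) - ?g (x + a *\<^sub>R u + 0 *\<^sub>R v))" by auto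
  have "\<exists>c. 0 < c \<and> c < t \<and> ?g (x + a *\<^sub>R u + t *\<^sub>R v) - ?g (x + a *\<^sub>R u + 0 *\<^sub>R v)
      = (t - 0) * frechet_derivative ?g (at (x + a *\<^sub>R u + c *\<^sub>R v)) v"
    using t a by (intro MVT2 D2) auto
  then obtain c where c: "0 < c" "c < t" "?g (x + a *\<^sub>R u + t *\<^sub>R v) - ?g (x + a *\<^sub>R u + 0 *\<^sub>R v)
      = t * frechet_derivative ?g (at (x + a *\<^sub>R u + c *\<^sub>R v)) v" by auto
  show ?thesis
    using a(3) c(3) in_ball[of a c] a c
    by (intro bexI[of _ "x + a *\<^sub>R u + c *\<^sub>R v"]) (auto simp: power2_eq_square)
qed

text \<open>The second difference is symmetric in \<open>u\<close> and \<open>v\<close>, so the two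
  mixed derivatives agree at two points arbitrarily close to \<open>x\<close>. By continuity they
  cannot differ at \<open>x\<close>.\<close>

lemma symmetric_second_derivative:
  fixes f :: "'a::real_normed_vector \<Rightarrow> real"
  assumes S: "open S" and f: "smooth_on S f" and x: "x \<in> S"
  shows "frechet_derivative (\<lambda>z. frechet_derivative f (at z) u) (at x) v
    = frechet_derivative (\<lambda>z. frechet_derivative f (at z) v) (at x) u"
proof (rule ccontr)
  let ?D = "\<lambda>u v z. frechet_derivative (\<lambda>z. frechet_derivative f (at z) u) (at z) v"
  assume neq: "?D u v x \<noteq> ?D v u x"
  \<comment> \<open>Half the supposed gap: a single number cannot be within this distance of both
    values.\<close>
  let ?e = "\<bar>?D u v x - ?D v u x\<bar> / 2"
  have cont: "continuous_on S (?D u v)" for u v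
    using smooth_on_continuous_on smooth_on_frechet_derivative f by blast
  have "\<exists>d>0. \<forall>z. dist z x < d \<longrightarrow> \<bar>?D u v z - ?D u v x\<bar> < ?e" for u v
  proof -
    have "isCont (?D u v) x" using cont S x by (simp add: continuous_on_eq_continuous_at)
    moreover have "?e > 0" using neq by simp
    ultimately show ?thesis unfolding continuous_at_eps_delta dist_real_def by blast
  qed
  then obtain d1 d2 where d: "d1 > 0" "\<And>z. dist z x < d1 \<Longrightarrow> \<bar>?D u v z - ?D u v x\<bar> < ?e"
    "d2 > 0" "\<And>z. dist z x < d2 \<Longrightarrow> \<bar>?D v u z - ?D v u x\<bar> < ?e" by metis
  obtain e where e: "e > 0" "ball x e \<subseteq> S" using S x openE by blast
  define r where "r = min e (min d1 d2)"
  have r: "r > 0" "ball x r \<subseteq> S" using d e by (auto simp: r_def)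
  \<comment> \<open>The summand 1 keeps the denominator positive even when \<open>u\<close> and
    \<open>v\<close> vanish; the factor 2 makes the parallelogram fit strictly inside the ball of
    radius \<open>r\<close>.\<close>
  define t where "t = r / (2 * (norm u + norm v + 1))"
  have n: "0 \<le> norm u + norm v" by simp
  have tpos: "t > 0" using r n by (simp add: t_def add_nonneg_pos)
  have "t * (norm u + norm v) \<le> t * (norm u + norm v + 1)" using tpos by simp
  also have "\<dots> = r / 2" using n by (simp add: t_def field_simps add_nonneg_eq_0_iff)
  finally have small: "t * (norm u + norm v) < r" using r by simp
  obtain z1 where z1: "z1 \<in> ball x r"
    "f (x + t *\<^sub>R u + t *\<^sub>R v) - f (x + t *\<^sub>R u) - f (x + t *\<^sub>R v) + f x = t\<^sup>2 * ?D u v z1"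
    using second_difference_mvt[OF f r(2) tpos small] by auto
  obtain z2 where z2: "z2 \<in> ball x r"
    "f (x + t *\<^sub>R v + t *\<^sub>R u) - f (x + t *\<^sub>R v) - f (x + t *\<^sub>R u) + f x = t\<^sup>2 * ?D v u z2"
    using second_difference_mvt[OF f r(2) tpos, of v u] small by (auto simp: add.commute)
  have "t\<^sup>2 * ?D u v z1 = t\<^sup>2 * ?D v u z2"
    using z1(2) z2(2) by (simp add: algebra_simps)
  then have "?D u v z1 = ?D v u z2" using tpos by simp
  moreover have "\<bar>?D u v z1 - ?D u v x\<bar> < ?e" "\<bar>?D v u z2 - ?D v u x\<bar> < ?e"
    using d(2)[of z1] d(4)[of z2] z1(1) z2(1) by (auto simp: r_def dist_commute)
  moreover have "\<bar>z - p\<bar> < \<bar>p - q\<bar> / 2 \<Longrightarrow> \<not> \<bar>z - q\<bar> < \<bar>p - q\<bar> / 2" for p q z :: real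
    by (auto simp: abs_if split: if_splits)
  ultimately show False by metis
qed

section \<open>Functions of position and direction\<close>

text \<open>The differential of \<open>f\<close> at (x, y) in the direction (a, b), written through
  the partial derivatives. With (a, b) = (y, -2G) it is the derivative along the spray.\<close>

definition total_diff :: "'n local_fun \<Rightarrow> real^'n \<Rightarrow> real^'n \<Rightarrow> real^'n \<Rightarrow> real^'n \<Rightarrow> real" where
  "total_diff f x y a b = (\<Sum>k\<in>UNIV. a $ k * dx k f x y) + (\<Sum>k\<in>UNIV. b $ k * dy k f x y)"

lemma dx_eq:
  assumes "(case_prod f has_derivative f') (at (x, y))"
  shows "dx k f x y = f' (axis k 1, 0)"
proof -
  have "((\<lambda>t. case_prod f ((x, y) + t *\<^sub>R (axis k 1, 0))) has_real_derivative f' (axis k 1, 0)) (at 0)"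
    using assms by (intro has_real_derivative_along_line) (simp add: zero_prod_def)
  then show ?thesis
    unfolding dx_def by (intro DERIV_imp_deriv) simp
qed

lemma dy_eq:
  assumes "(case_prod f has_derivative f') (at (x, y))"
  shows "dy k f x y = f' (0, axis k 1)"
proof -
  have "((\<lambda>t. case_prod f ((x, y) + t *\<^sub>R (0, axis k 1))) has_real_derivative f' (0, axis k 1)) (at 0)"
    using assms by (intro has_real_derivative_along_line) (simp add: zero_prod_def)
  then show ?thesis
    unfolding dy_def by (intro DERIV_imp_deriv) simp
qed

lemma sum_axis_scaleR: "(\<Sum>k\<in>UNIV. a $ k *\<^sub>R axis k 1) = (a :: real^'n)"
  using basis_expansion[of a] by (simp add: scalar_mult_eq_scaleR)

text \<open>By linearity a derivative is determined by its values on the standard basis. This lets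
  derivatives produced by the chain rule be compared with \<open>dx\<close> and \<open>dy\<close>,
  which are defined through one-variable derivatives.\<close>

lemma total_diff_eq:
  assumes "(case_prod f has_derivative f') (at (x, y))"
  shows "f' (a, b) = total_diff f x y a b"
proof -
  have lin: "linear f'" using assms has_derivative_linear by blast
  have "(a, b) = (\<Sum>k\<in>UNIV. a $ k *\<^sub>R (axis k 1, 0)) + (\<Sum>k\<in>UNIV. b $ k *\<^sub>R (0, axis k 1))"
    by (simp add: prod_eq_iff fst_sum snd_sum sum_axis_scaleR)
  then have "f' (a, b) = (\<Sum>k\<in>UNIV. a $ k * f' (axis k 1, 0)) + (\<Sum>k\<in>UNIV. b $ k * f' (0, axis k 1))"
    by (simp only: linear_add[OF lin] linear_sum[OF lin] linear_scale[OF lin] real_scaleR_def)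
  then show ?thesis by (simp add: total_diff_def dx_eq[OF assms] dy_eq[OF assms])
qed

lemma has_derivative_total_diff:
  assumes "smooth_on S (case_prod f)" "(x, y) \<in> S"
  shows "(case_prod f has_derivative (\<lambda>(a, b). total_diff f x y a b)) (at (x, y))"
proof -
  have d: "(case_prod f has_derivative frechet_derivative (case_prod f) (at (x, y))) (at (x, y))"
    using smooth_on_has_derivative assms by blast
  have "frechet_derivative (case_prod f) (at (x, y)) = (\<lambda>(a, b). total_diff f x y a b)"
    using total_diff_eq[OF d] by auto
  then show ?thesis using d by simp
qed

lemma smooth_on_dx:
  assumes "open S" "smooth_on S (case_prod f)"
  shows "smooth_on S (case_prod (dx k f))"
  by (rule smooth_on_cong[OF assms(1) _ smooth_on_frechet_derivative[OF assms(2), of "(axis k 1, 0)"]])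
    (use dx_eq[OF smooth_on_has_derivative[OF assms(2)]] in auto)

lemma smooth_on_dy:
  assumes "open S" "smooth_on S (case_prod f)"
  shows "smooth_on S (case_prod (dy k f))"
  by (rule smooth_on_cong[OF assms(1) _ smooth_on_frechet_derivative[OF assms(2), of "(0, axis k 1)"]])
    (use dy_eq[OF smooth_on_has_derivative[OF assms(2)]] in auto)

lemma dy_dy_commute:
  assumes S: "open S" and f: "smooth_on S (case_prod f)" and z: "(x, y) \<in> S"
  shows "dy i (dy j f) x y = dy j (dy i f) x y"
proof -
  have "dy i (dy j f) x y
      = frechet_derivative (\<lambda>z. frechet_derivative (case_prod f) (at z) (0, axis j 1)) (at (x, y)) (0, axis i 1)" for i j
  proof (rule dy_eq)
    show "(case_prod (dy j f) has_derivative
        frechet_derivative (\<lambda>z. frechet_derivative (case_prod f) (at z) (0, axis j 1)) (at (x, y))) (at (x, y))"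
      by (rule has_derivative_transform_within_open[OF smooth_on_has_derivative[OF
              smooth_on_frechet_derivative[OF f] z] S z])
        (use dy_eq[OF smooth_on_has_derivative[OF f]] in auto)
  qed
  then show ?thesis using symmetric_second_derivative[OF S f z] by simp
qed

text \<open>Partial derivatives only see values near the point. This is needed because the
  coordinate identities are available on open sets such as the slit domain only.\<close>

lemma total_diff_cong:
  assumes "open S" "smooth_on S (case_prod g)" "(x, y) \<in> S"
    "\<And>x y. (x, y) \<in> S \<Longrightarrow> f x y = g x y"
  shows "dx k f x y = dx k g x y" "dy k f x y = dy k g x y"
proof -
  have d: "(case_prod f has_derivative (\<lambda>(a, b). total_diff g x y a b)) (at (x, y))"
    by (rule has_derivative_transform_within_open[OF has_derivative_total_diff[OF assms(2,3)] assms(1,3)])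
      (use assms(4) in auto)
  note d' = has_derivative_total_diff[OF assms(2,3)]
  show "dx k f x y = dx k g x y" "dy k f x y = dy k g x y"
    using dx_eq[OF d] dx_eq[OF d'] dy_eq[OF d] dy_eq[OF d'] by simp_all
qed

section \<open>Homogeneity in the direction and Euler's theorem\<close>

definition homogeneous_on :: "(real^'n) set \<Rightarrow> nat \<Rightarrow> 'n local_fun \<Rightarrow> bool" where
  "homogeneous_on U m f \<longleftrightarrow> (\<forall>x\<in>U. \<forall>y. y \<noteq> 0 \<longrightarrow> (\<forall>t>0. f x (t *\<^sub>R y) = t ^ m * f x y))"

lemma open_slit: "open U \<Longrightarrow> open (U \<times> (UNIV - {0::'a::real_normed_vector}))"
  by (simp add: open_Times open_delete)

text \<open>Both sides are the derivative at (x, y) of the map sending (x, y) to f(x, ty) = t^m f(x,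
  y); the inner scaling multiplies the vertical direction by \<open>t\<close>.\<close>

lemma homogeneous_total_diff:
  assumes U: "open U" and f: "smooth_on (U \<times> (UNIV - {0})) (case_prod f)" and h: "homogeneous_on U m f"
    and x: "x \<in> U" "y \<noteq> 0" "t > 0"
  shows "total_diff f x (t *\<^sub>R y) a (t *\<^sub>R b) = t ^ m * total_diff f x y a b"
proof -
  let ?S = "U \<times> (UNIV - {0})"
  have z: "(x, y) \<in> ?S" "(x, t *\<^sub>R y) \<in> ?S" using x by auto
  have "((\<lambda>z. case_prod f (fst z, t *\<^sub>R snd z)) has_derivative
      (\<lambda>h. (case (fst h, t *\<^sub>R snd h) of (a, b) \<Rightarrow> total_diff f x (t *\<^sub>R y) a b))) (at (x, y))"
    by (rule has_derivative_compose[of "\<lambda>z. (fst z, t *\<^sub>R snd z)" "\<lambda>h. (fst h, t *\<^sub>R snd h)"])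
      (use has_derivative_total_diff[OF f z(2)] in \<open>auto intro!: derivative_eq_intros\<close>)
  then have "((\<lambda>z. case_prod f (fst z, t *\<^sub>R snd z)) has_derivative
      (\<lambda>h. total_diff f x (t *\<^sub>R y) (fst h) (t *\<^sub>R snd h))) (at (x, y))"
    by simp
  then have d1: "((\<lambda>z. t ^ m * case_prod f z) has_derivative
      (\<lambda>h. total_diff f x (t *\<^sub>R y) (fst h) (t *\<^sub>R snd h))) (at (x, y))"
    by (rule has_derivative_transform_within_open[OF _ open_slit[OF U] z(1)])
      (auto intro: h[unfolded homogeneous_on_def, rule_format, OF _ _ x(3)])
  have d2: "((\<lambda>z. t ^ m * case_prod f z) has_derivative
      (\<lambda>h. t ^ m * total_diff f x y (fst h) (snd h))) (at (x, y))"
    using has_derivative_mult_right[OF has_derivative_total_diff[OF f z(1)], of "t ^ m"]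
    by (simp add: case_prod_unfold)
  show ?thesis
    using fun_cong[OF has_derivative_unique[OF d1 d2], of "(a, b)"] by simp
qed

text \<open>A purely horizontal direction is not affected by the scaling, so the degree is
  kept.\<close>

lemma homogeneous_dx:
  assumes "open U" "smooth_on (U \<times> (UNIV - {0})) (case_prod f)" "homogeneous_on U m f"
  shows "homogeneous_on U m (dx k f)"
proof -
  have "total_diff f x y (axis k 1) 0 = dx k f x y" for x y
    by (simp add: total_diff_def axis_def if_distrib[where f="\<lambda>c. c * _"] cong: if_cong)
  then show ?thesis
    using homogeneous_total_diff[OF assms, of _ _ _ "axis k 1" 0] by (auto simp: homogeneous_on_def)
qed

text \<open>A vertical direction absorbs one factor \<open>t\<close>, so the degree drops by
  one.\<close>

lemma homogeneous_dy:
  assumes "open U" "smooth_on (U \<times> (UNIV - {0})) (case_prod f)" "homogeneous_on U (Suc m) f"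
  shows "homogeneous_on U m (dy k f)"
proof -
  have eq: "total_diff f x y 0 (t *\<^sub>R axis k 1) = t * dy k f x y" for x y t
    by (simp add: total_diff_def axis_def if_distrib[where f="\<lambda>c. c * _"] if_distrib[where f="\<lambda>c. _ * c"] cong: if_cong)
  then have "t * dy k f x (t *\<^sub>R y) = t ^ Suc m * dy k f x y" if "x \<in> U" "y \<noteq> 0" "t > 0" for x y t
    using homogeneous_total_diff[OF assms that, of 0 "axis k 1"] eq[of x y 1] by (simp add: eq)
  then show ?thesis by (auto simp: homogeneous_on_def)
qed

text \<open>The identity f(x, ty) = t^m f(x, y) is differentiated in \<open>t\<close> at
  \<open>t = 1\<close>.\<close>

lemma euler_homogeneous:
  assumes U: "open U" and f: "smooth_on (U \<times> (UNIV - {0})) (case_prod f)" and h: "homogeneous_on U m f"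
    and x: "x \<in> U" "y \<noteq> 0"
  shows "(\<Sum>k\<in>UNIV. y $ k * dy k f x y) = real m * f x y"
proof -
  have z: "(x, y) \<in> U \<times> (UNIV - {0})" using x by auto
  have "((\<lambda>t. case_prod f (x, t *\<^sub>R y)) has_derivative
      (\<lambda>t. (case (0, t *\<^sub>R y) of (a, b) \<Rightarrow> total_diff f x y a b))) (at 1)"
    by (rule has_derivative_compose[of "\<lambda>t. (x, t *\<^sub>R y)" "\<lambda>t. (0, t *\<^sub>R y)"])
      (use has_derivative_total_diff[OF f z] in \<open>auto intro!: derivative_eq_intros\<close>)
  then have "((\<lambda>t. f x (t *\<^sub>R y)) has_derivative (\<lambda>t. total_diff f x y 0 (t *\<^sub>R y))) (at 1)"
    by simp
  then have d1: "((\<lambda>t. t ^ m * f x y) has_derivative (\<lambda>t. total_diff f x y 0 (t *\<^sub>R y))) (at 1)"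
    by (rule has_derivative_transform_within_open[of _ _ _ _ "{0<..}"])
      (use h x in \<open>auto simp: homogeneous_on_def\<close>)
  have d2: "((\<lambda>t. t ^ m * f x y) has_derivative (\<lambda>t. t * (real m * f x y))) (at 1)"
    by (auto intro!: derivative_eq_intros)
  have "total_diff f x y 0 (1 *\<^sub>R y) = 1 * (real m * f x y)"
    using fun_cong[OF has_derivative_unique[OF d1 d2], of 1] by simp
  then show ?thesis by (simp add: total_diff_def)
qed

section \<open>Coordinate changes on the tangent bundle\<close>

lemma Ck_on_bounded_linear_compose:
  assumes S: "open S" and l: "bounded_linear l" and "Ck_on k S f"
  shows "Ck_on k S (\<lambda>x. l (f x))"
  using assms(3)
proof (induction k arbitrary: f)
  case 0
  then show ?case using bounded_linear.continuous_on[OF l] by simp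
next
  case (Suc k)
  show ?case
    by (rule Ck_on_SucI[OF S bounded_linear.has_derivative[OF l Ck_on_Suc_has_derivative[OF Suc.prems]]])
      (use Suc in auto)
qed

lemma smooth_on_nth: "open S \<Longrightarrow> smooth_on S f \<Longrightarrow> smooth_on S (\<lambda>x. f x $ i)"
  unfolding smooth_on_def using Ck_on_bounded_linear_compose[OF _ bounded_linear_vec_nth] by blast

lemma symmetric_second_derivative_vec:
  fixes f :: "'a::real_normed_vector \<Rightarrow> real^'n"
  assumes S: "open S" and f: "smooth_on S f" and x: "x \<in> S"
  shows "frechet_derivative (\<lambda>z. frechet_derivative f (at z) u) (at x) v
    = frechet_derivative (\<lambda>z. frechet_derivative f (at z) v) (at x) u"
proof (rule vec_eq_iff[THEN iffD2, rule_format])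
  fix i
  have d: "frechet_derivative (\<lambda>z. g z $ i) (at z) = (\<lambda>h. frechet_derivative g (at z) h $ i)"
    if "smooth_on S g" "z \<in> S" for g :: "'a \<Rightarrow> real^'n" and z
    using frechet_derivative_at[OF bounded_linear.has_derivative[OF bounded_linear_vec_nth
          smooth_on_has_derivative[OF that]]] by metis
  have "frechet_derivative (\<lambda>z. frechet_derivative (\<lambda>z. f z $ i) (at z) u) (at x) v
      = frechet_derivative (\<lambda>z. frechet_derivative f (at z) u) (at x) v $ i" for u v
  proof -
    have "((\<lambda>z. frechet_derivative (\<lambda>z. f z $ i) (at z) u) has_derivative
        (\<lambda>h. frechet_derivative (\<lambda>z. frechet_derivative f (at z) u) (at x) h $ i)) (at x)"
      by (rule has_derivative_transform_within_open[OF bounded_linear.has_derivative[OF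
              bounded_linear_vec_nth smooth_on_has_derivative[OF
                smooth_on_frechet_derivative[OF f] x]] S x]) (simp add: d[OF f])
    then show ?thesis using frechet_derivative_at by metis
  qed
  then show "frechet_derivative (\<lambda>z. frechet_derivative f (at z) u) (at x) v $ i
    = frechet_derivative (\<lambda>z. frechet_derivative f (at z) v) (at x) u $ i"
    using symmetric_second_derivative[OF S smooth_on_nth[OF S f] x] by metis
qed

lemma matrix_vector_mult_sum_axis:
  "(M::real^'n^'m) *v y = (\<Sum>k\<in>UNIV. y $ k *\<^sub>R (M *v axis k 1))"
proof -
  have "M *v y = M *v (\<Sum>k\<in>UNIV. y $ k *\<^sub>R axis k 1)"
    by (simp add: sum_axis_scaleR)
  also have "\<dots> = (\<Sum>k\<in>UNIV. y $ k *\<^sub>R (M *v axis k 1))"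
    by (simp only: linear_sum[OF matrix_vector_mul_linear] linear_scale[OF matrix_vector_mul_linear])
  finally show ?thesis .
qed

text \<open>The second derivative D^2 phi(u, v) of the coordinate change phi. Defining it through
  the Jacobian gives it directly the form in which it appears when transformation laws are
  differentiated.\<close>

definition transition_hess ::
  "('m, real^'n) chart \<Rightarrow> ('m, real^'n) chart \<Rightarrow> real^'n \<Rightarrow> real^'n \<Rightarrow> real^'n \<Rightarrow> real^'n" where
  "transition_hess c c' x u v = frechet_derivative (\<lambda>z. transition_jac c c' z *v v) (at x) u"

section \<open>Transition maps with their first and second derivatives\<close>

locale smooth_manifold =
  fixes A :: "('m::{t2_space, second_countable_topology}, real^'n) chart set"
  assumes atlas: "smooth_atlas A"
begin

lemma is_chart: "c \<in> A \<Longrightarrow> is_chart c"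
  using atlas by (simp add: smooth_atlas_def)

lemma open_chart_range: "c \<in> A \<Longrightarrow> open (snd c ` fst c)"
  using is_chart by (simp add: is_chart_def)

lemma open_slit_dom: "c \<in> A \<Longrightarrow> open (slit_dom c)"
  by (simp add: slit_dom_def open_slit open_chart_range)

lemma inj_on_chart: "c \<in> A \<Longrightarrow> inj_on (snd c) (fst c)"
  using is_chart unfolding is_chart_def homeomorphism_def by (metis inj_on_inverseI)

lemma chart_inv_chart: "c \<in> A \<Longrightarrow> p \<in> fst c \<Longrightarrow> chart_inv c (snd c p) = p"
  by (simp add: chart_inv_def inj_on_chart)

lemma chart_inv_in: "x \<in> snd c ` fst c \<Longrightarrow> chart_inv c x \<in> fst c"
  by (simp add: chart_inv_def inv_into_into)

lemma chart_chart_inv: "x \<in> snd c ` fst c \<Longrightarrow> snd c (chart_inv c x) = x"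
  by (simp add: chart_inv_def f_inv_into_f)

text \<open>A chart is a homeomorphism onto an open set, hence maps relatively open sets to open
  ones. Openness is what permits differentiating identities that hold on the overlap.\<close>

lemma open_transition_dom:
  assumes "c \<in> A" "c' \<in> A"
  shows "open (transition_dom c c')"
proof -
  obtain \<psi> where "homeomorphism (fst c) (snd c ` fst c) (snd c) \<psi>"
    using is_chart[OF assms(1)] by (auto simp: is_chart_def)
  moreover have "openin (top_of_set (fst c)) (fst c \<inter> fst c')"
    using is_chart[OF assms(2)] by (auto simp: is_chart_def)
  ultimately have "openin (top_of_set (snd c ` fst c)) (snd c ` (fst c \<inter> fst c'))"
    using homeomorphism_imp_open_map by blast
  then show ?thesis
    using open_chart_range[OF assms(1)] openin_open_trans by (auto simp: transition_dom_def)
qed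

lemma transition_dom_iff:
  assumes "c \<in> A"
  shows "x \<in> transition_dom c c' \<longleftrightarrow> x \<in> snd c ` fst c \<and> chart_inv c x \<in> fst c'"
proof
  assume "x \<in> transition_dom c c'"
  then obtain p where "p \<in> fst c" "p \<in> fst c'" "x = snd c p"
    by (auto simp: transition_dom_def)
  then show "x \<in> snd c ` fst c \<and> chart_inv c x \<in> fst c'"
    using chart_inv_chart[OF assms] by simp
next
  assume "x \<in> snd c ` fst c \<and> chart_inv c x \<in> fst c'"
  then show "x \<in> transition_dom c c'"
    unfolding transition_dom_def by (metis IntI chart_chart_inv chart_inv_in image_eqI)
qed

lemma chart_inv_transition:
  "c \<in> A \<Longrightarrow> c' \<in> A \<Longrightarrow> x \<in> transition_dom c c' \<Longrightarrow> chart_inv c' (transition c c' x) = chart_inv c x"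
  by (simp add: transition_def transition_dom_iff chart_inv_chart)

lemma transition_in:
  assumes "c \<in> A" "c' \<in> A" "x \<in> transition_dom c c'"
  shows "transition c c' x \<in> transition_dom c' c"
proof -
  have "x \<in> snd c ` fst c" "chart_inv c x \<in> fst c'"
    using assms(3)[unfolded transition_dom_iff[OF assms(1)]] by blast+
  then show ?thesis using chart_inv_in[of x c] by (simp add: transition_dom_def transition_def)
qed

lemma transition_transition:
  assumes "c \<in> A" "c' \<in> A" "x \<in> transition_dom c c'"
  shows "transition c' c'' (transition c c' x) = transition c c'' x"
  using chart_inv_transition[OF assms] by (simp add: transition_def)

lemma smooth_on_transition:
  "c \<in> A \<Longrightarrow> c' \<in> A \<Longrightarrow> smooth_on (transition_dom c c') (transition c c')"
  using atlas by (simp add: smooth_atlas_def)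

lemma transition_jac_eq:
  assumes "c \<in> A" "c' \<in> A" "x \<in> transition_dom c c'"
  shows "transition_jac c c' x *v v = frechet_derivative (transition c c') (at x) v"
  unfolding transition_jac_def
  by (rule matrix_works)
    (simp only: linear_matrix_vector_mul_eq has_derivative_linear[OF smooth_on_has_derivative[OF
          smooth_on_transition[OF assms(1,2)] assms(3)]])

lemma has_derivative_transition:
  assumes "c \<in> A" "c' \<in> A" "x \<in> transition_dom c c'"
  shows "(transition c c' has_derivative (*v) (transition_jac c c' x)) (at x)"
proof -
  have "(*v) (transition_jac c c' x) = frechet_derivative (transition c c') (at x)"
    using transition_jac_eq[OF assms] by auto
  then show ?thesis
    using smooth_on_has_derivative[OF smooth_on_transition assms(3)] assms by simp
qed

text \<open>Chain rule for the composite of two coordinate changes, which coincides with the direct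
  change near \<open>x\<close>; uniqueness of derivatives then compares the Jacobians.\<close>

lemma transition_jac_cocycle:
  assumes c: "c \<in> A" "c' \<in> A" "c'' \<in> A" and x: "x \<in> transition_dom c c'" "x \<in> transition_dom c c''"
  shows "transition_jac c' c'' (transition c c' x) *v (transition_jac c c' x *v v)
    = transition_jac c c'' x *v v"
proof -
  have x': "transition c c' x \<in> transition_dom c' c''"
    using x c transition_in[OF c(1,2) x(1)] chart_inv_transition[OF c(1,2) x(1)]
    by (simp add: transition_dom_iff)
  have "((\<lambda>z. transition c' c'' (transition c c' z)) has_derivative
      (\<lambda>v. transition_jac c' c'' (transition c c' x) *v (transition_jac c c' x *v v))) (at x)"
    by (rule has_derivative_compose[OF has_derivative_transition has_derivative_transition])
      (use c x x' in auto)
  then have "(transition c c'' has_derivative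
      (\<lambda>v. transition_jac c' c'' (transition c c' x) *v (transition_jac c c' x *v v))) (at x)"
    by (rule has_derivative_transform_within_open[OF _ open_transition_dom[OF c(1,2)] x(1)])
      (use transition_transition c in auto)
  from has_derivative_unique[OF this has_derivative_transition[OF c(1,3) x(2)]]
  show ?thesis by metis
qed

lemma transition_jac_self:
  assumes c: "c \<in> A" and x: "x \<in> snd c ` fst c"
  shows "transition_jac c c x *v v = v"
proof -
  have x': "x \<in> transition_dom c c" using x by (simp add: transition_dom_def)
  have "((\<lambda>z. z) has_derivative (*v) (transition_jac c c x)) (at x)"
    by (rule has_derivative_transform_within_open[OF has_derivative_transition[OF c c x']
          open_transition_dom[OF c c] x'])
      (auto simp: transition_def transition_dom_def chart_inv_chart[OF c])
  from has_derivative_unique[OF this has_derivative_ident] show ?thesis by metis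
qed

text \<open>The cocycle identity with first and last chart equal, read once from \<open>c\<close>
  and once from \<open>c'\<close>.\<close>

lemma transition_jac_inverse:
  assumes c: "c \<in> A" "c' \<in> A" and x: "x \<in> transition_dom c c'"
  shows "transition_jac c' c (transition c c' x) *v (transition_jac c c' x *v v) = v"
    and "transition_jac c c' x *v (transition_jac c' c (transition c c' x) *v v) = v"
proof -
  have x1: "x \<in> snd c ` fst c" "x \<in> transition_dom c c"
    using x by (auto simp: transition_dom_def)
  show "transition_jac c' c (transition c c' x) *v (transition_jac c c' x *v v) = v"
    using transition_jac_cocycle[OF c(1,2,1) x x1(2)] transition_jac_self[OF c(1) x1(1)] by simp
  let ?x' = "transition c c' x"
  have x2: "?x' \<in> transition_dom c' c" "?x' \<in> snd c' ` fst c'" "?x' \<in> transition_dom c' c'"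
    using transition_in[OF c x] by (auto simp: transition_dom_def)
  have "transition c' c ?x' = x"
    using transition_transition[OF c x, of c] chart_chart_inv[OF x1(1)] by (simp add: transition_def)
  then show "transition_jac c c' x *v (transition_jac c' c (transition c c' x) *v v) = v"
    using transition_jac_cocycle[OF c(2,1,2) x2(1,3)] transition_jac_self[OF c(2) x2(2)] by simp
qed

lemma transition_slit:
  assumes c: "c \<in> A" "c' \<in> A" and x: "x \<in> transition_dom c c'" and y: "y \<noteq> 0"
  shows "(transition c c' x, transition_jac c c' x *v y) \<in> slit_dom c'"
proof -
  have "transition_jac c c' x *v y \<noteq> 0"
    using transition_jac_inverse(1)[OF c x, of y] y by (metis matrix_vector_mult_0_right)
  then show ?thesis
    using transition_in[OF c x] by (auto simp: slit_dom_def transition_dom_def)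
qed

lemma has_derivative_transition_jac:
  assumes c: "c \<in> A" "c' \<in> A" and x: "x \<in> transition_dom c c'"
  shows "((\<lambda>z. transition_jac c c' z *v v) has_derivative (\<lambda>u. transition_hess c c' x u v)) (at x)"
proof -
  let ?f = "\<lambda>z. frechet_derivative (transition c c') (at z) v"
  have "(?f has_derivative frechet_derivative ?f (at x)) (at x)"
    using smooth_on_has_derivative[OF smooth_on_frechet_derivative[OF smooth_on_transition[OF c]] x] .
  then have d: "((\<lambda>z. transition_jac c c' z *v v) has_derivative frechet_derivative ?f (at x)) (at x)"
    by (rule has_derivative_transform_within_open[OF _ open_transition_dom[OF c] x])
      (simp only: transition_jac_eq[OF c])
  show ?thesis
    using d unfolding transition_hess_def frechet_derivative_at[OF d, symmetric] .
qed

text \<open>This symmetry is what cancels the Hessian terms in the Euler-Lagrange equations and what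
  yields the factor 2 when D^2 phi(y, y) is differentiated.\<close>

lemma transition_hess_commute:
  assumes c: "c \<in> A" "c' \<in> A" and x: "x \<in> transition_dom c c'"
  shows "transition_hess c c' x u v = transition_hess c c' x v u"
proof -
  have "transition_hess c c' x u v
      = frechet_derivative (\<lambda>z. frechet_derivative (transition c c') (at z) v) (at x) u" for u v
    unfolding transition_hess_def
    by (rule fun_cong[OF frechet_derivative_transform_within_open[OF _ open_transition_dom[OF c] x]])
      (use has_derivative_transition_jac[OF c x] in \<open>auto simp: transition_jac_eq c differentiable_def\<close>)
  then show ?thesis
    using symmetric_second_derivative_vec[OF open_transition_dom[OF c] smooth_on_transition[OF c] x] by simp
qed

lemma transition_hess_sum_axis:
  assumes c: "c \<in> A" "c' \<in> A" and x: "x \<in> transition_dom c c'"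
  shows "transition_hess c c' x a y = (\<Sum>k\<in>UNIV. y $ k *\<^sub>R transition_hess c c' x a (axis k 1))"
proof -
  have "((\<lambda>z. transition_jac c c' z *v y) has_derivative
      (\<lambda>a. \<Sum>k\<in>UNIV. y $ k *\<^sub>R transition_hess c c' x a (axis k 1))) (at x)"
    by (subst matrix_vector_mult_sum_axis)
      (intro has_derivative_sum has_derivative_scaleR_right has_derivative_transition_jac c x)
  from has_derivative_unique[OF this has_derivative_transition_jac[OF c x]]
  show ?thesis by metis
qed

text \<open>The differential of the induced coordinate change (phi(x), Jy). Expanding
  \<open>y\<close> in the standard basis reduces the matrix-vector product to scalar multiples,
  where the product rule applies.\<close>

lemma has_derivative_tangent_transition:
  assumes c: "c \<in> A" "c' \<in> A" and x: "x \<in> transition_dom c c'"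
  shows "((\<lambda>(x, y). (transition c c' x, transition_jac c c' x *v y)) has_derivative
    (\<lambda>(a, b). (transition_jac c c' x *v a, transition_hess c c' x a y + transition_jac c c' x *v b))) (at (x, y))"
proof -
  have d1: "((\<lambda>z. transition c c' (fst z)) has_derivative (\<lambda>h. transition_jac c c' x *v fst h)) (at (x, y))"
    by (rule has_derivative_compose[OF has_derivative_fst[OF has_derivative_ident]])
      (use has_derivative_transition[OF c x] in simp)
  have d2: "((\<lambda>z. transition_jac c c' (fst z) *v axis k 1) has_derivative
      (\<lambda>h. transition_hess c c' x (fst h) (axis k 1))) (at (x, y))" for k
    by (rule has_derivative_compose[OF has_derivative_fst[OF has_derivative_ident]])
      (use has_derivative_transition_jac[OF c x] in simp)
  have d3: "((\<lambda>z. snd z $ k) has_derivative (\<lambda>h. snd h $ k)) (at (x, y))" for k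
    by (auto intro!: derivative_eq_intros bounded_linear.has_derivative[OF bounded_linear_vec_nth])
  have "((\<lambda>z. transition_jac c c' (fst z) *v snd z) has_derivative
      (\<lambda>h. \<Sum>k\<in>UNIV. snd (x, y) $ k *\<^sub>R transition_hess c c' x (fst h) (axis k 1)
         + snd h $ k *\<^sub>R (transition_jac c c' (fst (x, y)) *v axis k 1))) (at (x, y))"
    by (subst matrix_vector_mult_sum_axis) (intro has_derivative_sum has_derivative_scaleR d2 d3)
  then have "((\<lambda>z. transition_jac c c' (fst z) *v snd z) has_derivative
      (\<lambda>h. transition_hess c c' x (fst h) y + transition_jac c c' x *v snd h)) (at (x, y))"
    by (simp add: sum.distrib transition_hess_sum_axis[OF c x, of _ y, symmetric]
        matrix_vector_mult_sum_axis[symmetric])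
  from has_derivative_Pair[OF d1 this] show ?thesis
    by (simp add: case_prod_unfold)
qed

text \<open>Compatibility of the components is the cocycle identity. Membership is needed because
  the homogeneity of \<open>F\<close> is assumed on the tangent bundle only.\<close>

lemma tangent_point_in:
  assumes c: "c \<in> A" and x: "x \<in> snd c ` fst c"
  shows "tangent_point A c x y \<in> tangent_bundle A"
proof -
  have "transition_jac c' c'' (snd c' (chart_inv c x)) *v (transition_jac c c' x *v y) = transition_jac c c'' x *v y"
    if "c' \<in> A" "c'' \<in> A" "chart_inv c x \<in> fst c'" "chart_inv c x \<in> fst c''" for c' c''
    using transition_jac_cocycle[OF c that(1,2), of x y] that x
    by (simp add: transition_dom_iff c transition_def)
  then show ?thesis
    by (auto simp: tangent_bundle_def tangent_point_def tangent_space_def)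
qed

lemma tangent_point_transition:
  assumes c: "c \<in> A" "c' \<in> A" and x: "x \<in> transition_dom c c'"
  shows "tangent_point A c' (transition c c' x) (transition_jac c c' x *v y) = tangent_point A c x y"
proof -
  have "transition_jac c' c'' (transition c c' x) *v (transition_jac c c' x *v y) = transition_jac c c'' x *v y"
    if "c'' \<in> A" "chart_inv c x \<in> fst c''" for c''
    using transition_jac_cocycle[OF c that(1) x] that(2) x transition_dom_iff[OF c(1)] by blast
  then show ?thesis
    by (simp add: tangent_point_def fun_eq_iff chart_inv_transition[OF c x])
qed

lemma local_rep_transition:
  "c \<in> A \<Longrightarrow> c' \<in> A \<Longrightarrow> x \<in> transition_dom c c' \<Longrightarrow>
    local_rep A f c' (transition c c' x) (transition_jac c c' x *v y) = local_rep A f c x y"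
  by (simp add: local_rep_def tangent_point_transition)

lemma tangent_point_scaleR:
  "tangent_point A c x (t *\<^sub>R y) = (fst (tangent_point A c x y), \<lambda>c'. t *\<^sub>R snd (tangent_point A c x y) c')"
  by (auto simp: tangent_point_def matrix_vector_mult_scaleR)

end

section \<open>The spray of a Finsler metric\<close>

lemma matrix_inv_mult_right:
  fixes M :: "'a::semiring_1^'n^'m"
  assumes "invertible M" shows "M ** matrix_inv M = mat 1"
  using someI_ex[OF assms[unfolded invertible_def]] unfolding matrix_inv_def by blast

lemma total_diff_scaleR: "total_diff f x y (t *\<^sub>R a) (t *\<^sub>R b) = t * total_diff f x y a b"
  by (simp add: total_diff_def sum_distrib_left algebra_simps)

lemma sum_axis_mult:
  fixes f :: "'n::finite \<Rightarrow> real"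
  shows "(\<Sum>k\<in>UNIV. axis j 1 $ k * f k) = f j"
proof -
  have "(\<Sum>k\<in>UNIV. axis j 1 $ k * f k) = (\<Sum>k\<in>UNIV. if k = j then f k else 0)"
    by (rule sum.cong) (auto simp: axis_def)
  then show ?thesis by simp
qed

lemma smooth_on_snd_nth: "smooth_on S (\<lambda>(x, y). (y::real^'n) $ k)"
  unfolding case_prod_unfold
  by (intro smooth_on_bounded_linear bounded_linear_compose[OF bounded_linear_vec_nth bounded_linear_snd])

lemma (in smooth_manifold) has_derivative_pullback:
  assumes c: "c \<in> A" "c' \<in> A" and f: "smooth_on (slit_dom c') (case_prod f)"
    and x: "x \<in> transition_dom c c'" and y: "y \<noteq> 0"
  shows "((\<lambda>(x, y). f (transition c c' x) (transition_jac c c' x *v y)) has_derivative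
    (\<lambda>(a, b). total_diff f (transition c c' x) (transition_jac c c' x *v y) (transition_jac c c' x *v a)
      (transition_hess c c' x a y + transition_jac c c' x *v b))) (at (x, y))"
proof -
  have "((\<lambda>z. case_prod f ((\<lambda>(x, y). (transition c c' x, transition_jac c c' x *v y)) z)) has_derivative
    (\<lambda>h. (\<lambda>(a, b). total_diff f (transition c c' x) (transition_jac c c' x *v y) a b)
      ((\<lambda>(a, b). (transition_jac c c' x *v a, transition_hess c c' x a y + transition_jac c c' x *v b)) h))) (at (x, y))"
    by (rule has_derivative_compose[OF has_derivative_tangent_transition[OF c x]])
      (use has_derivative_total_diff[OF f transition_slit[OF c x y]] in simp)
  then show ?thesis by (simp add: case_prod_unfold)
qed

lemma (in smooth_manifold) open_transition_slit:
  "c \<in> A \<Longrightarrow> c' \<in> A \<Longrightarrow> open (transition_dom c c' \<times> (UNIV - {0::real^'n}))"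
  using open_slit open_transition_dom by blast

text \<open>Linear in the first argument as a derivative, hence in the second by symmetry.\<close>

lemma (in smooth_manifold) bounded_bilinear_transition_hess:
  assumes c: "c \<in> A" "c' \<in> A" and x: "x \<in> transition_dom c c'"
  shows "bounded_bilinear (transition_hess c c' x)"
proof -
  have lin: "linear (\<lambda>u. transition_hess c c' x u v)" for v
    using has_derivative_linear[OF has_derivative_transition_jac[OF c x]] .
  moreover have "linear (\<lambda>u. transition_hess c c' x v u)" for v
    using lin[of v] unfolding transition_hess_commute[OF c x, of _ v] .
  ultimately show ?thesis
    by (simp add: bilinear_conv_bounded_bilinear[symmetric] bilinear_def)
qed

text \<open>The columns of an invertible Jacobian span the space. Thus equations contracted with the
  Jacobian imply the equations themselves.\<close>

lemma (in smooth_manifold) orthogonal_to_transition_jac: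
  assumes c: "c \<in> A" "c' \<in> A" and x: "x \<in> transition_dom c c'"
    and q: "\<And>l. (transition_jac c c' x *v axis l 1) \<bullet> q = 0"
  shows "q = 0"
proof -
  have "(transition_jac c c' x *v v) \<bullet> q = 0" for v
    by (subst matrix_vector_mult_sum_axis) (simp add: inner_sum_left q)
  then have "q \<bullet> q = 0" using transition_jac_inverse(2)[OF c x] by metis
  then show ?thesis by simp
qed

section \<open>The Euler-Lagrange equations, smoothness and homogeneity of the spray\<close>

definition spray_vec ::
  "('m, real^'n) chart set \<Rightarrow> ('m \<times> ('m, real^'n) tangent_vector \<Rightarrow> real) \<Rightarrow>
     ('m, real^'n) chart \<Rightarrow> real^'n \<Rightarrow> real^'n \<Rightarrow> real^'n" where
  "spray_vec A F c x y = (\<chi> i. spray A F c i x y)"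

definition nonlinear_connection ::
  "('m, real^'n) chart set \<Rightarrow> ('m \<times> ('m, real^'n) tangent_vector \<Rightarrow> real) \<Rightarrow>
     ('m, real^'n) chart \<Rightarrow> real^'n \<Rightarrow> real^'n \<Rightarrow> real^'n^'n" where
  "nonlinear_connection A F c x y = (\<chi> i j. dy j (spray A F c i) x y)"

locale finsler_manifold = smooth_manifold A
  for A :: "('m::{t2_space, second_countable_topology}, real^'n) chart set" +
  fixes F :: "'m \<times> ('m, real^'n) tangent_vector \<Rightarrow> real"
  assumes metric: "finsler_metric A F"
begin

abbreviation "L \<equiv> energy A F"
abbreviation "G \<equiv> spray A F"

lemma smooth_energy:
  assumes "c \<in> A" shows "smooth_on (slit_dom c) (case_prod (L c))"
proof -
  have "smooth_on (slit_dom c) (\<lambda>(x, y). local_rep A F c x y)"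
    using metric assms by (simp add: finsler_metric_def smooth_scalar_def)
  from smooth_on_mult[OF open_slit_dom[OF assms] this this]
  show ?thesis by (simp add: energy_def power2_eq_square case_prod_unfold)
qed

lemma homogeneous_energy:
  assumes "c \<in> A" shows "homogeneous_on (snd c ` fst c) 2 (L c)"
proof -
  have "local_rep A F c x (t *\<^sub>R y) = t * local_rep A F c x y"
    if x: "x \<in> snd c ` fst c" and t: "t > 0" for x y t
  proof -
    have "\<forall>(p, v)\<in>tangent_bundle A. \<forall>t>0. F (p, \<lambda>c. t *\<^sub>R v c) = t * F (p, v)"
      using metric by (simp add: finsler_metric_def)
    from bspec[OF this tangent_point_in[OF assms x, of y]] t show ?thesis
      by (simp add: local_rep_def tangent_point_scaleR case_prod_unfold)
  qed
  then show ?thesis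
    by (simp add: homogeneous_on_def energy_def power_mult_distrib)
qed

lemma smooth_dy_energy: "c \<in> A \<Longrightarrow> smooth_on (slit_dom c) (case_prod (dy l (L c)))"
  by (intro smooth_on_dy open_slit_dom smooth_energy)

lemma fund_tensor_nondegenerate:
  assumes "c \<in> A" "(x, y) \<in> slit_dom c" "fund_tensor A F c x y *v v = 0"
  shows "v = 0"
proof (rule ccontr)
  assume "v \<noteq> 0"
  moreover have "\<forall>(x, y)\<in>slit_dom c. \<forall>v. v \<noteq> 0 \<longrightarrow> v \<bullet> (fund_tensor A F c x y *v v) > 0"
    using metric assms(1) by (simp add: finsler_metric_def)
  ultimately show False using assms(2,3) by fastforce
qed

lemma invertible_fund_tensor:
  assumes "c \<in> A" "(x, y) \<in> slit_dom c"
  shows "invertible (fund_tensor A F c x y)"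
  using fund_tensor_nondegenerate[OF assms] by (simp add: invertible_left_inverse matrix_left_invertible_ker)

text \<open>The spray coefficients with lowered index, that is, before the inverse of the
  fundamental tensor is applied.\<close>

definition euler_lagrange_rhs :: "('m, real^'n) chart \<Rightarrow> real^'n \<Rightarrow> real^'n \<Rightarrow> real^'n" where
  "euler_lagrange_rhs c x y = (\<chi> l. 1/4 * ((\<Sum>k\<in>UNIV. dx k (dy l (L c)) x y * y $ k) - dx l (L c) x y))"

lemma fund_tensor_spray:
  assumes "c \<in> A" "(x, y) \<in> slit_dom c"
  shows "fund_tensor A F c x y *v spray_vec A F c x y = euler_lagrange_rhs c x y"
proof -
  have "spray_vec A F c x y = matrix_inv (fund_tensor A F c x y) *v euler_lagrange_rhs c x y"
    by (simp add: vec_eq_iff spray_vec_def spray_def euler_lagrange_rhs_def matrix_vector_mult_def sum_distrib_left)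
  then show ?thesis
    using matrix_inv_mult_right[OF invertible_fund_tensor[OF assms]] by (simp add: matrix_vector_mul_assoc)
qed

text \<open>The vertical Hessian of the energy is twice the fundamental tensor; commuting the
  vertical derivatives matches the order of indices.\<close>

lemma total_diff_dy_energy:
  assumes "c \<in> A" "(x, y) \<in> slit_dom c"
  shows "total_diff (dy l (L c)) x y a b
    = (\<Sum>k\<in>UNIV. dx k (dy l (L c)) x y * a $ k) + 2 * (fund_tensor A F c x y *v b) $ l"
proof -
  have "(\<Sum>k\<in>UNIV. b $ k * dy k (dy l (L c)) x y) = 2 * (fund_tensor A F c x y *v b) $ l"
    using dy_dy_commute[OF open_slit_dom smooth_energy assms(2), of _ l] assms(1)
    by (simp add: matrix_vector_mult_def fund_tensor_def sum_distrib_left mult.commute)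
  then show ?thesis by (simp add: total_diff_def mult.commute)
qed

text \<open>Along a curve with x' = y and y' = -2G these are the Euler-Lagrange equations of the
  energy.\<close>

lemma euler_lagrange:
  assumes "c \<in> A" "(x, y) \<in> slit_dom c"
  shows "total_diff (dy l (L c)) x y y (- 2 *\<^sub>R spray_vec A F c x y) = dx l (L c) x y"
  by (simp only: total_diff_dy_energy[OF assms] linear_scale[OF matrix_vector_mul_linear] fund_tensor_spray[OF assms])
    (simp add: euler_lagrange_rhs_def field_simps)

text \<open>Two solutions differ by a vector in the kernel of the fundamental tensor. Both the
  homogeneity and the transformation law of the spray are obtained by exhibiting a solution.\<close>

lemma euler_lagrange_unique:
  assumes "c \<in> A" "(x, y) \<in> slit_dom c"
    and w: "\<And>l. total_diff (dy l (L c)) x y y w = dx l (L c) x y"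
  shows "w = - 2 *\<^sub>R spray_vec A F c x y"
proof -
  have "(fund_tensor A F c x y *v w) $ l = (fund_tensor A F c x y *v (- 2 *\<^sub>R spray_vec A F c x y)) $ l" for l
    using w[of l] euler_lagrange[OF assms(1,2), of l]
    unfolding total_diff_dy_energy[OF assms(1,2)] by linarith
  then have "fund_tensor A F c x y *v (w - (- 2 *\<^sub>R spray_vec A F c x y)) = 0"
    unfolding matrix_vector_mult_diff_distrib by (simp add: vec_eq_iff)
  from fund_tensor_nondegenerate[OF assms(1,2) this] show ?thesis by (simp only: right_minus_eq)
qed

text \<open>The spray solves a linear system with smooth coefficients, so Cramer's rule writes each
  coefficient as a quotient of smooth determinants, and \<open>matrix_inv\<close> need not be
  differentiated.\<close>

lemma smooth_spray:
  assumes c: "c \<in> A" shows "smooth_on (slit_dom c) (case_prod (G c i))"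
proof -
  let ?g = "\<lambda>z. fund_tensor A F c (fst z) (snd z)"
  let ?b = "\<lambda>z. euler_lagrange_rhs c (fst z) (snd z)"
  \<comment> \<open>The fundamental tensor with column \<open>i\<close> replaced by the right-hand
    side, as in Cramer's rule.\<close>
  let ?C = "\<lambda>z. \<chi> k j. if j = i then ?b z $ k else ?g z $ k $ j"
  note S = open_slit_dom[OF c]
  have g: "smooth_on (slit_dom c) (\<lambda>z. ?g z $ k $ j)" for k j
    using smooth_on_mult[OF S smooth_on_const[where c="1/2"] smooth_on_dy[OF S smooth_dy_energy[OF c], of k j]]
    by (simp add: fund_tensor_def case_prod_unfold)
  have dxdy: "smooth_on (slit_dom c) (\<lambda>z. dx k (dy l (L c)) (fst z) (snd z))"
    "smooth_on (slit_dom c) (\<lambda>z. dx l (L c) (fst z) (snd z))" "smooth_on (slit_dom c) (\<lambda>z. snd z $ k)" for k l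
    using smooth_on_dx[OF S smooth_dy_energy[OF c], of k l] smooth_on_dx[OF S smooth_energy[OF c], of l]
      smooth_on_snd_nth[of "slit_dom c" k]
    by (simp_all add: case_prod_unfold)
  have b: "smooth_on (slit_dom c) (\<lambda>z. ?b z $ k)" for k
    unfolding euler_lagrange_rhs_def
    by (simp, intro smooth_on_divide smooth_on_minus smooth_on_sum smooth_on_mult smooth_on_const S dxdy) simp
  have C: "smooth_on (slit_dom c) (\<lambda>z. ?C z $ k $ j)" for k j
    using g[of k j] b[of k] by (cases "j = i") simp_all
  have nz: "det (?g z) \<noteq> 0" if "z \<in> slit_dom c" for z
    using invertible_fund_tensor[OF c, of "fst z" "snd z"] that by (simp add: invertible_det_nz)
  have "det (?C z) / det (?g z) = case_prod (G c i) z" if "z \<in> slit_dom c" for z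
  proof -
    have "?g z *v spray_vec A F c (fst z) (snd z) = ?b z"
      using fund_tensor_spray[OF c, of "fst z" "snd z"] that by simp
    from this[unfolded cramer[OF nz[OF that]]]
    have "spray_vec A F c (fst z) (snd z) $ i = det (?C z) / det (?g z)" by simp
    then show ?thesis by (simp add: spray_vec_def case_prod_unfold)
  qed
  then show ?thesis
    by (rule smooth_on_cong[OF S _ smooth_on_divide[OF S smooth_on_det[OF S C] smooth_on_det[OF S g] nz]])
qed

text \<open>Scaling the Euler-Lagrange equations at (x, y) by \<open>t\<close> squared shows that
  t^2 G(x, y) solves them at (x, ty).\<close>

lemma homogeneous_spray:
  assumes c: "c \<in> A" shows "homogeneous_on (snd c ` fst c) 2 (G c i)"
  unfolding homogeneous_on_def
proof (intro ballI allI impI)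
  fix x :: "real^'n" and y :: "real^'n" and t :: real
  assume x: "x \<in> snd c ` fst c" and y: "y \<noteq> 0" and t: "t > 0"
  then have z: "(x, y) \<in> slit_dom c" and tz: "(x, t *\<^sub>R y) \<in> slit_dom c" by (auto simp: slit_dom_def)
  note U = open_chart_range[OF c]
  note sm = smooth_energy[OF c, unfolded slit_dom_def] smooth_dy_energy[OF c, unfolded slit_dom_def]
  have h1: "homogeneous_on (snd c ` fst c) 1 (dy l (L c))" for l
    using homogeneous_dy[OF U sm(1), of 1] homogeneous_energy[OF c] by (simp add: numeral_2_eq_2)
  have h2: "homogeneous_on (snd c ` fst c) 2 (dx l (L c))" for l
    using homogeneous_dx[OF U sm(1)] homogeneous_energy[OF c] by blast
  let ?w = "- 2 *\<^sub>R spray_vec A F c x y"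
  \<comment> \<open>One factor \<open>t\<close> on the last argument is used up by homogeneity, the
    other by linearity of the differential.\<close>
  have "total_diff (dy l (L c)) x (t *\<^sub>R y) (t *\<^sub>R y) (t *\<^sub>R (t *\<^sub>R ?w)) = dx l (L c) x (t *\<^sub>R y)" for l
  proof -
    have "total_diff (dy l (L c)) x (t *\<^sub>R y) (t *\<^sub>R y) (t *\<^sub>R (t *\<^sub>R ?w))
        = t ^ 1 * total_diff (dy l (L c)) x y (t *\<^sub>R y) (t *\<^sub>R ?w)"
      by (rule homogeneous_total_diff[OF U sm(2) h1 x y t])
    also have "\<dots> = t ^ 2 * dx l (L c) x y"
      by (simp only: total_diff_scaleR euler_lagrange[OF c z] power2_eq_square mult.assoc power_one_right)
    also have "\<dots> = dx l (L c) x (t *\<^sub>R y)"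
      using h2[of l, unfolded homogeneous_on_def, rule_format, OF x y t] by simp
    finally show ?thesis .
  qed
  from arg_cong[OF euler_lagrange_unique[OF c tz this], of "\<lambda>v. v $ i"]
  show "G c i x (t *\<^sub>R y) = t\<^sup>2 * G c i x y"
    by (simp add: spray_vec_def power2_eq_square)
qed

lemma euler_spray:
  assumes c: "c \<in> A" and z: "(x, y) \<in> slit_dom c"
  shows "(\<Sum>m\<in>UNIV. y $ m * dy m (G c r) x y) = 2 * G c r x y"
    and "(\<Sum>m\<in>UNIV. y $ m * dy m (dy j (G c r)) x y) = dy j (G c r) x y"
proof -
  note U = open_chart_range[OF c]
  note sm = smooth_spray[OF c, unfolded slit_dom_def]
  have sm': "smooth_on (snd c ` fst c \<times> (UNIV - {0})) (case_prod (dy j (G c r)))"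
    by (rule smooth_on_dy[OF open_slit[OF U] sm])
  have h: "homogeneous_on (snd c ` fst c) 1 (dy j (G c r))"
    using homogeneous_dy[OF U sm, of 1] homogeneous_spray[OF c] by (simp add: numeral_2_eq_2)
  have xy: "x \<in> snd c ` fst c" "y \<noteq> 0" using z by (auto simp: slit_dom_def)
  show "(\<Sum>m\<in>UNIV. y $ m * dy m (G c r) x y) = 2 * G c r x y"
    using euler_homogeneous[OF U sm homogeneous_spray[OF c] xy] by simp
  show "(\<Sum>m\<in>UNIV. y $ m * dy m (dy j (G c r)) x y) = dy j (G c r) x y"
    using euler_homogeneous[OF U sm' h xy] by simp
qed

section \<open>Transformation of the spray and of its vertical derivative\<close>

lemma energy_transition:
  "c \<in> A \<Longrightarrow> c' \<in> A \<Longrightarrow> x \<in> transition_dom c c' \<Longrightarrow>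
    L c' (transition c c' x) (transition_jac c c' x *v y) = L c x y"
  by (simp add: energy_def local_rep_transition)

text \<open>The Euler-Lagrange equations are invariant under changes of charts, and they determine the
  spray.\<close>

lemma spray_transition:
  assumes c: "c \<in> A" "c' \<in> A" and x: "x \<in> transition_dom c c'" and y: "y \<noteq> 0"
  defines "J \<equiv> transition_jac c c' x" and "H \<equiv> transition_hess c c' x"
  shows "- 2 *\<^sub>R spray_vec A F c' (transition c c' x) (J *v y)
    = H y y + J *v (- 2 *\<^sub>R spray_vec A F c x y)"
proof -
  let ?S = "transition_dom c c' \<times> (UNIV - {0})"
  let ?x' = "transition c c' x" and ?y' = "J *v y"
  let ?L' = "L c'"
  note S = open_transition_slit[OF c]
  have z: "(x, y) \<in> ?S" using x y by auto
  have zc: "(x, y) \<in> slit_dom c" if "(x, y) \<in> ?S" for x y :: "real^'n"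
    using that by (auto simp: slit_dom_def transition_dom_def)
  have z': "(?x', ?y') \<in> slit_dom c'" using transition_slit[OF c x y] by (simp add: J_def)
  \<comment> \<open>On the overlap the energy in \<open>c\<close> is the pullback of the energy in
    \<open>c'\<close>.\<close>
  have dL: "(case_prod (L c) has_derivative
      (\<lambda>(a, b). total_diff ?L' (transition c c' x) (transition_jac c c' x *v y) (transition_jac c c' x *v a)
         (transition_hess c c' x a y + transition_jac c c' x *v b))) (at (x, y))"
    if "(x, y) \<in> ?S" for x y
    by (rule has_derivative_transform_within_open[OF has_derivative_pullback[OF c smooth_energy[OF c(2)]] S that])
      (use that in \<open>auto simp: energy_transition c\<close>)
  have zero: "transition_hess c c' x 0 y = 0" if "x \<in> transition_dom c c'" for x y
    using linear_0[OF has_derivative_linear[OF has_derivative_transition_jac[OF c that]]] .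
  \<comment> \<open>No Hessian term occurs for a vertical direction, so the vertical derivatives
    transform as a covector.\<close>
  have dyL: "dy l (L c) x y = (\<Sum>p\<in>UNIV. (transition_jac c c' x *v axis l 1) $ p
      * dy p ?L' (transition c c' x) (transition_jac c c' x *v y))" if "(x, y) \<in> ?S" for x y l
    using dy_eq[OF dL[OF that], of l] zero[of x y] that by (simp add: total_diff_def)
  have dxL: "dx l (L c) x y = (\<Sum>p\<in>UNIV. (J *v axis l 1) $ p * dx p ?L' ?x' ?y')
      + (\<Sum>p\<in>UNIV. H (axis l 1) y $ p * dy p ?L' ?x' ?y')" for l
    using dx_eq[OF dL[OF z], of l] by (simp add: total_diff_def J_def H_def)
  \<comment> \<open>The vertical part of the image of (y, -2G) under the differential of the
    coordinate change: the candidate for -2G' in \<open>c'\<close>.\<close>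
  define w where "w = H y y + J *v (- 2 *\<^sub>R spray_vec A F c x y)"
  have ddL: "total_diff (dy l (L c)) x y y (- 2 *\<^sub>R spray_vec A F c x y)
      = (\<Sum>p\<in>UNIV. (J *v axis l 1) $ p * total_diff (dy p ?L') ?x' ?y' ?y' w)
        + (\<Sum>p\<in>UNIV. H y (axis l 1) $ p * dy p ?L' ?x' ?y')" for l
  proof -
    have j: "((\<lambda>z. (transition_jac c c' (fst z) *v axis l 1) $ p) has_derivative (\<lambda>h. H (fst h) (axis l 1) $ p)) (at (x, y))" for p
      unfolding H_def
      by (rule has_derivative_compose[of fst fst "(x, y)" UNIV "\<lambda>x. (transition_jac c c' x *v axis l 1) $ p"])
        (use bounded_linear.has_derivative[OF bounded_linear_vec_nth has_derivative_transition_jac[OF c x]]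
          in \<open>auto intro!: derivative_eq_intros\<close>)
    have "((\<lambda>z. \<Sum>p\<in>UNIV. (transition_jac c c' (fst z) *v axis l 1) $ p *
          (\<lambda>(x, y). dy p ?L' (transition c c' x) (transition_jac c c' x *v y)) z) has_derivative
        (\<lambda>h. \<Sum>p\<in>UNIV. (transition_jac c c' (fst (x, y)) *v axis l 1) $ p *
            (\<lambda>(a, b). total_diff (dy p ?L') ?x' (transition_jac c c' x *v y) (transition_jac c c' x *v a)
               (transition_hess c c' x a y + transition_jac c c' x *v b)) h
          + H (fst h) (axis l 1) $ p * (\<lambda>(x, y). dy p ?L' (transition c c' x) (transition_jac c c' x *v y)) (x, y)))
        (at (x, y))"
      by (intro has_derivative_sum has_derivative_mult j has_derivative_pullback[OF c smooth_dy_energy[OF c(2)] x y])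
    then have "(case_prod (dy l (L c)) has_derivative
        (\<lambda>h. \<Sum>p\<in>UNIV. (transition_jac c c' (fst (x, y)) *v axis l 1) $ p *
            (\<lambda>(a, b). total_diff (dy p ?L') ?x' (transition_jac c c' x *v y) (transition_jac c c' x *v a)
               (transition_hess c c' x a y + transition_jac c c' x *v b)) h
          + H (fst h) (axis l 1) $ p * (\<lambda>(x, y). dy p ?L' (transition c c' x) (transition_jac c c' x *v y)) (x, y)))
        (at (x, y))"
      by (rule has_derivative_transform_within_open[OF _ S z]) (auto intro!: dyL[symmetric])
    from total_diff_eq[OF this, of y "- 2 *\<^sub>R spray_vec A F c x y"] show ?thesis
      by (simp add: sum.distrib J_def H_def w_def)
  qed
  \<comment> \<open>The defect of \<open>w\<close> in the Euler-Lagrange equations of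
    \<open>c'\<close>. Subtracting \<open>dxL\<close> from \<open>ddL\<close> cancels the Hessian
    terms by symmetry and leaves \<open>q\<close> contracted with the columns of
    \<open>J\<close>.\<close>
  define q where "q = (\<chi> p. total_diff (dy p ?L') ?x' ?y' ?y' w - dx p ?L' ?x' ?y')"
  have "(J *v axis l 1) \<bullet> q = 0" for l
    using euler_lagrange[OF c(1) zc[OF z], of l] transition_hess_commute[OF c x, of y "axis l 1"]
    unfolding ddL dxL by (simp add: q_def inner_vec_def algebra_simps sum_subtractf H_def)
  then have "q = 0"
    using orthogonal_to_transition_jac[OF c x] by (simp add: J_def)
  then have "total_diff (dy p ?L') ?x' ?y' ?y' w = dx p ?L' ?x' ?y'" for p
    by (simp add: q_def vec_eq_iff)
  from euler_lagrange_unique[OF c(2) z' this] show ?thesis by (simp add: w_def)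
qed

text \<open>The transformation law of the spray is differentiated in \<open>y\<close>. By symmetry
  D^2 phi(y, y) contributes 2 D^2 phi(y, b), and the common factor 2 cancels.\<close>

lemma nonlinear_connection_transition:
  assumes c: "c \<in> A" "c' \<in> A" and x: "x \<in> transition_dom c c'" and y: "y \<noteq> 0"
  defines "J \<equiv> transition_jac c c' x" and "H \<equiv> transition_hess c c' x"
  shows "H y b = J *v (nonlinear_connection A F c x y *v b)
    - nonlinear_connection A F c' (transition c c' x) (J *v y) *v (J *v b)"
proof (rule vec_eq_iff[THEN iffD2, rule_format])
  fix r
  let ?x' = "transition c c' x"
  have zc: "(x, y) \<in> slit_dom c" using x y by (auto simp: slit_dom_def transition_dom_def)
  have z': "(?x', J *v y) \<in> slit_dom c'" using transition_slit[OF c x y] by (simp add: J_def)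
  \<comment> \<open>Used with the Jacobian as \<open>M\<close> for the chart \<open>c'\<close> and
    with the identity matrix for \<open>c\<close>.\<close>
  have fibre: "((\<lambda>y. f x (M *v y)) has_derivative (\<lambda>b. \<Sum>j\<in>UNIV. (M *v b) $ j * dy j f x (M *v y))) (at y)"
    if "smooth_on S (case_prod f)" "(x, M *v y) \<in> S"
    for f :: "'n local_fun" and S x and M :: "real^'n^'n"
  proof -
    have "((\<lambda>y. case_prod f (x, M *v y)) has_derivative (\<lambda>b. (case (0, M *v b) of (a, b) \<Rightarrow> total_diff f x (M *v y) a b))) (at y)"
      by (rule has_derivative_compose[of "\<lambda>y. (x, M *v y)" "\<lambda>b. (0, M *v b)"])
        (use has_derivative_total_diff[OF that] in \<open>auto intro!: derivative_eq_intros
          bounded_linear.has_derivative[OF matrix_vector_mul_bounded_linear]\<close>)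
    then show ?thesis by (simp add: total_diff_def)
  qed
  have d1: "((\<lambda>y. - 2 * G c' r ?x' (J *v y)) has_derivative
      (\<lambda>b. - 2 * (\<Sum>j\<in>UNIV. (J *v b) $ j * dy j (G c' r) ?x' (J *v y)))) (at y)"
    by (intro has_derivative_mult_right fibre[OF smooth_spray[OF c(2)] z'])
  have d0: "((\<lambda>y. G c i x y) has_derivative (\<lambda>b. \<Sum>j\<in>UNIV. b $ j * dy j (G c i) x y)) (at y)" for i
    using fibre[OF smooth_spray[OF c(1)], of x "mat 1"] zc by simp
  have dH: "((\<lambda>y. H y y) has_derivative (\<lambda>b. H y b + H b y)) (at y)"
    unfolding H_def
    by (rule bounded_bilinear.FDERIV[OF bounded_bilinear_transition_hess[OF c x]]) (rule has_derivative_ident)+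
  have d2: "((\<lambda>y. H y y $ r + - 2 * (\<Sum>i\<in>UNIV. J $ r $ i * G c i x y)) has_derivative
      (\<lambda>b. (H y b + H b y) $ r + - 2 * (\<Sum>i\<in>UNIV. J $ r $ i * (\<Sum>j\<in>UNIV. b $ j * dy j (G c i) x y)))) (at y)"
    by (intro has_derivative_add has_derivative_mult_right has_derivative_sum d0
        bounded_linear.has_derivative[OF bounded_linear_vec_nth dH])
  have law: "- 2 * G c' r ?x' (J *v y) = H y y $ r + - 2 * (\<Sum>i\<in>UNIV. J $ r $ i * G c i x y)" if "y \<noteq> 0" for y
    using arg_cong[OF spray_transition[OF c x that], of "\<lambda>v. v $ r"]
    by (simp add: spray_vec_def J_def H_def matrix_vector_mult_def sum_distrib_left sum_negf algebra_simps)
  have "((\<lambda>y. - 2 * G c' r ?x' (J *v y)) has_derivative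
      (\<lambda>b. (H y b + H b y) $ r + - 2 * (\<Sum>i\<in>UNIV. J $ r $ i * (\<Sum>j\<in>UNIV. b $ j * dy j (G c i) x y)))) (at y)"
    by (rule has_derivative_transform_within_open[OF d2, of "UNIV - {0}"]) (use y law in auto)
  from fun_cong[OF has_derivative_unique[OF d1 this], of b]
  have "- 2 * (nonlinear_connection A F c' ?x' (J *v y) *v (J *v b)) $ r
      = (H y b + H b y) $ r + - 2 * (J *v (nonlinear_connection A F c x y *v b)) $ r"
    by (simp add: nonlinear_connection_def matrix_vector_mult_def mult.commute)
  moreover have "H b y = H y b"
    using transition_hess_commute[OF c x] by (simp add: H_def)
  ultimately show "H y b $ r = (J *v (nonlinear_connection A F c x y *v b)
      - nonlinear_connection A F c' (transition c c' x) (J *v y) *v (J *v b)) $ r"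
    by simp
qed

end

section \<open>The horizontal derivative of a tensor along the spray\<close>

definition trilinear_form :: "('n \<Rightarrow> 'n \<Rightarrow> 'n \<Rightarrow> real) \<Rightarrow> real^'n \<Rightarrow> real^'n \<Rightarrow> real^'n \<Rightarrow> real" where
  "trilinear_form t u v w = (\<Sum>p\<in>UNIV. \<Sum>q\<in>UNIV. \<Sum>r\<in>UNIV. t p q r * u $ p * v $ q * w $ r)"

text \<open>This swap and the next one reduce statements about the second and third slots to the
  first.\<close>

lemma trilinear_form_swap12: "trilinear_form t u v w = trilinear_form (\<lambda>q p r. t p q r) v u w"
  unfolding trilinear_form_def by (subst sum.swap) (simp add: mult_ac)

lemma trilinear_form_swap23: "trilinear_form t u v w = trilinear_form (\<lambda>p r q. t p q r) u w v"
  unfolding trilinear_form_def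
  by (rule sum.cong[OF refl], subst sum.swap) (simp add: mult_ac)

lemma linear_trilinear_form1: "linear (\<lambda>u. trilinear_form t u v w)"
  by (rule linearI) (simp_all add: trilinear_form_def sum_distrib_left sum.distrib algebra_simps)

lemma linear_trilinear_form2: "linear (\<lambda>v. trilinear_form t u v w)"
  using linear_trilinear_form1[of "\<lambda>q p r. t p q r" u w]
  unfolding trilinear_form_swap12[of t u] .

lemma linear_trilinear_form3: "linear (\<lambda>w. trilinear_form t u v w)"
  using linear_trilinear_form2[of "\<lambda>p r q. t p q r" u v]
  unfolding trilinear_form_swap23[of t u v] .

text \<open>Moves the matrix from an index of the coefficients to the matching argument, the form in
  which the connection terms can be compared between charts.\<close>

lemma trilinear_form_contract1:
  "trilinear_form (\<lambda>p q r. \<Sum>s\<in>UNIV. t s q r * M $ s $ p) u v w = trilinear_form t (M *v u) v w"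
proof -
  \<comment> \<open>Brings the innermost of three summations to the outside.\<close>
  have rot: "(\<Sum>q\<in>UNIV. \<Sum>r\<in>UNIV. \<Sum>s\<in>UNIV. g q r s) = (\<Sum>s\<in>UNIV. \<Sum>q\<in>UNIV. \<Sum>r\<in>UNIV. g q r s)"
    for g :: "'a \<Rightarrow> 'a \<Rightarrow> 'a \<Rightarrow> real"
  proof -
    have "(\<Sum>q\<in>UNIV. \<Sum>r\<in>UNIV. \<Sum>s\<in>UNIV. g q r s) = (\<Sum>q\<in>UNIV. \<Sum>s\<in>UNIV. \<Sum>r\<in>UNIV. g q r s)"
      by (rule sum.cong[OF refl], rule sum.swap)
    also have "\<dots> = (\<Sum>s\<in>UNIV. \<Sum>q\<in>UNIV. \<Sum>r\<in>UNIV. g q r s)"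
      by (rule sum.swap)
    finally show ?thesis .
  qed
  have "trilinear_form t (M *v u) v w = (\<Sum>p\<in>UNIV. u $ p * trilinear_form t (M *v axis p 1) v w)"
    by (subst matrix_vector_mult_sum_axis)
      (simp add: linear_sum[OF linear_trilinear_form1] linear_scale[OF linear_trilinear_form1])
  also have "\<dots> = (\<Sum>p\<in>UNIV. \<Sum>s\<in>UNIV. \<Sum>q\<in>UNIV. \<Sum>r\<in>UNIV. t s q r * M $ s $ p * u $ p * v $ q * w $ r)"
    by (simp add: trilinear_form_def matrix_vector_mult_basis column_def sum_distrib_left mult_ac)
  also have "\<dots> = (\<Sum>p\<in>UNIV. \<Sum>q\<in>UNIV. \<Sum>r\<in>UNIV. \<Sum>s\<in>UNIV. t s q r * M $ s $ p * u $ p * v $ q * w $ r)"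
    by (rule sum.cong[OF refl]) (rule rot[symmetric])
  also have "\<dots> = trilinear_form (\<lambda>p q r. \<Sum>s\<in>UNIV. t s q r * M $ s $ p) u v w"
    by (simp add: trilinear_form_def sum_distrib_right)
  finally show ?thesis by simp
qed

lemma trilinear_form_contract2:
  "trilinear_form (\<lambda>p q r. \<Sum>s\<in>UNIV. t p s r * M $ s $ q) u v w = trilinear_form t u (M *v v) w"
  unfolding trilinear_form_swap12[of _ u v] trilinear_form_swap12[of t u]
  by (rule trilinear_form_contract1)

lemma trilinear_form_contract3:
  "trilinear_form (\<lambda>p q r. \<Sum>s\<in>UNIV. t p q s * M $ s $ r) u v w = trilinear_form t u v (M *v w)"
  unfolding trilinear_form_swap23[of _ u v w] trilinear_form_swap23[of t u v]
  by (rule trilinear_form_contract2)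

lemma trilinear_form_diff:
  "trilinear_form (\<lambda>p q r. s p q r - t p q r) u v w = trilinear_form s u v w - trilinear_form t u v w"
  by (simp add: trilinear_form_def sum_subtractf algebra_simps)

lemma has_derivative_trilinear_form:
  assumes t: "\<And>p q r. ((\<lambda>z. t z p q r) has_derivative (\<lambda>h. t' h p q r)) (at z)"
    and u: "(u has_derivative u') (at z)" and v: "(v has_derivative v') (at z)" and w: "(w has_derivative w') (at z)"
  shows "((\<lambda>z. trilinear_form (t z) (u z) (v z) (w z)) has_derivative
    (\<lambda>h. trilinear_form (t' h) (u z) (v z) (w z) + trilinear_form (t z) (u' h) (v z) (w z)
      + trilinear_form (t z) (u z) (v' h) (w z) + trilinear_form (t z) (u z) (v z) (w' h))) (at z)"
proof -
  note nth = bounded_linear.has_derivative[OF bounded_linear_vec_nth]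
  have "((\<lambda>z. trilinear_form (t z) (u z) (v z) (w z)) has_derivative
    (\<lambda>h. \<Sum>p\<in>UNIV. \<Sum>q\<in>UNIV. \<Sum>r\<in>UNIV. t z p q r * u z $ p * v z $ q * w' h $ r
      + (t z p q r * u z $ p * v' h $ q + (t z p q r * u' h $ p + t' h p q r * u z $ p) * v z $ q) * w z $ r)) (at z)"
    unfolding trilinear_form_def
    by (intro has_derivative_sum has_derivative_mult t nth[OF u] nth[OF v] nth[OF w])
  then show ?thesis
    by (simp add: trilinear_form_def sum.distrib algebra_simps)
qed

lemma smooth_on_total_diff:
  assumes "open S" "smooth_on S (case_prod f)"
    and "\<And>k. smooth_on S (\<lambda>(x, y). a x y $ k)" "\<And>k. smooth_on S (\<lambda>(x, y). b x y $ k)"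
  shows "smooth_on S (\<lambda>(x, y). total_diff f x y (a x y) (b x y))"
  unfolding total_diff_def case_prod_unfold
  by (intro smooth_on_add smooth_on_sum smooth_on_mult assms(1)
      smooth_on_dx[OF assms(1,2), unfolded case_prod_unfold]
      smooth_on_dy[OF assms(1,2), unfolded case_prod_unfold] assms(3,4)[unfolded case_prod_unfold])

lemma total_diff_mult_coordinate:
  assumes f: "smooth_on S (case_prod f)" "(x, y) \<in> S"
  shows "dx k (\<lambda>x y. f x y * y $ i) x y = dx k f x y * y $ i"
    and "dy k (\<lambda>x y. f x y * y $ i) x y = dy k f x y * y $ i + f x y * axis k 1 $ i"
proof -
  have s: "((\<lambda>z. snd z $ i) has_derivative (\<lambda>h. snd h $ i)) (at (x, y))"
    by (auto intro!: derivative_eq_intros bounded_linear.has_derivative[OF bounded_linear_vec_nth])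
  have d: "(case_prod (\<lambda>x y. f x y * y $ i) has_derivative
      (\<lambda>h. f x y * snd h $ i + total_diff f x y (fst h) (snd h) * y $ i)) (at (x, y))"
    using has_derivative_mult[OF has_derivative_total_diff[OF f] s] by (simp add: case_prod_unfold)
  note d' = has_derivative_total_diff[OF f]
  show "dx k (\<lambda>x y. f x y * y $ i) x y = dx k f x y * y $ i"
    using dx_eq[OF d] dx_eq[OF d'] by simp
  show "dy k (\<lambda>x y. f x y * y $ i) x y = dy k f x y * y $ i + f x y * axis k 1 $ i"
    using dy_eq[OF d] dy_eq[OF d'] by simp
qed

section \<open>Tensoriality of the derivative along the spray\<close>

context finsler_manifold
begin

text \<open>The derivative \<open>T\<^bsub>jkl|0\<^esub>\<close>, with Euler's theorem for \<open>G\<close> already applied.\<close>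

definition dynamical_deriv ::
  "(('m, real^'n) chart \<Rightarrow> 'n \<Rightarrow> 'n \<Rightarrow> 'n \<Rightarrow> 'n local_fun) \<Rightarrow>
     ('m, real^'n) chart \<Rightarrow> 'n \<Rightarrow> 'n \<Rightarrow> 'n \<Rightarrow> 'n local_fun" where
  "dynamical_deriv T c j k l = (\<lambda>x y.
     total_diff (T c j k l) x y y (- 2 *\<^sub>R spray_vec A F c x y)
     - (\<Sum>r\<in>UNIV. T c r k l x y * nonlinear_connection A F c x y $ r $ j)
     - (\<Sum>r\<in>UNIV. T c j r l x y * nonlinear_connection A F c x y $ r $ k)
     - (\<Sum>r\<in>UNIV. T c j k r x y * nonlinear_connection A F c x y $ r $ l))"

text \<open>The vectors \<open>transition_jac c c' x *v axis j 1\<close> are the columns of the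
  Jacobian, so the tensor law is an evaluation on columns, where multilinearity is
  available.\<close>

lemma tensor_field3_transition:
  assumes T: "tensor_field3 A T" and c: "c \<in> A" "c' \<in> A" and x: "x \<in> transition_dom c c'" and y: "y \<noteq> 0"
  shows "T c j k l x y = trilinear_form
    (\<lambda>p q r. T c' p q r (transition c c' x) (transition_jac c c' x *v y))
    (transition_jac c c' x *v axis j 1) (transition_jac c c' x *v axis k 1) (transition_jac c c' x *v axis l 1)"
  using T c x y unfolding tensor_field3_def Let_def trilinear_form_def
  by (simp add: matrix_vector_mult_basis column_def)

text \<open>Differentiating the tensor law along the spray produces one Hessian term per slot. Each
  equals JN - N'J on a basis vector: the JN parts cancel the connection terms of \<open>c\<close>,
  and the N'J parts form those of \<open>c'\<close>.\<close>

lemma dynamical_deriv_transition: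
  assumes T: "tensor_field3 A T" and c: "c \<in> A" "c' \<in> A" and x: "x \<in> transition_dom c c'" and y: "y \<noteq> 0"
  defines "J \<equiv> transition_jac c c' x"
  shows "dynamical_deriv T c j k l x y = trilinear_form
    (\<lambda>p q r. dynamical_deriv T c' p q r (transition c c' x) (J *v y))
    (J *v axis j 1) (J *v axis k 1) (J *v axis l 1)"
proof -
  let ?S = "transition_dom c c' \<times> (UNIV - {0})"
  define H where "H = transition_hess c c' x"
  define x' where "x' = transition c c' x"
  define y' where "y' = J *v y"
  define N where "N = nonlinear_connection A F c x y"
  define N' where "N' = nonlinear_connection A F c' x' y'"
  define e where "e i = J *v axis i 1" for i
  define t where "t p q r = T c' p q r x' y'" for p q r
  define s where "s p q r = total_diff (T c' p q r) x' y' y' (- 2 *\<^sub>R spray_vec A F c' x' y')" for p q r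
  note S = open_transition_slit[OF c]
  have z: "(x, y) \<in> ?S" using x y by auto
  have smT: "smooth_on (slit_dom c) (case_prod (T c j k l))" if "c \<in> A" for c j k l
    using T that by (simp add: tensor_field3_def)
  have dJ: "((\<lambda>z. transition_jac c c' (fst z) *v axis i 1) has_derivative (\<lambda>h. H (fst h) (axis i 1))) (at (x, y))" for i
    unfolding H_def
    by (rule has_derivative_compose[of fst fst "(x, y)" UNIV "\<lambda>x. transition_jac c c' x *v axis i 1"])
      (use has_derivative_transition_jac[OF c x] in \<open>auto intro!: derivative_eq_intros\<close>)
  have "((\<lambda>z. trilinear_form
        (\<lambda>p q r. (\<lambda>(x, y). T c' p q r (transition c c' x) (transition_jac c c' x *v y)) z)
        (transition_jac c c' (fst z) *v axis j 1) (transition_jac c c' (fst z) *v axis k 1)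
        (transition_jac c c' (fst z) *v axis l 1)) has_derivative
      (\<lambda>h. trilinear_form (\<lambda>p q r. (\<lambda>(a, b). total_diff (T c' p q r) x' (transition_jac c c' x *v y)
            (transition_jac c c' x *v a) (transition_hess c c' x a y + transition_jac c c' x *v b)) h)
          (transition_jac c c' (fst (x, y)) *v axis j 1) (transition_jac c c' (fst (x, y)) *v axis k 1)
          (transition_jac c c' (fst (x, y)) *v axis l 1)
        + trilinear_form (\<lambda>p q r. (\<lambda>(x, y). T c' p q r (transition c c' x) (transition_jac c c' x *v y)) (x, y))
          (H (fst h) (axis j 1)) (transition_jac c c' (fst (x, y)) *v axis k 1)
          (transition_jac c c' (fst (x, y)) *v axis l 1)
        + trilinear_form (\<lambda>p q r. (\<lambda>(x, y). T c' p q r (transition c c' x) (transition_jac c c' x *v y)) (x, y))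
          (transition_jac c c' (fst (x, y)) *v axis j 1) (H (fst h) (axis k 1))
          (transition_jac c c' (fst (x, y)) *v axis l 1)
        + trilinear_form (\<lambda>p q r. (\<lambda>(x, y). T c' p q r (transition c c' x) (transition_jac c c' x *v y)) (x, y))
          (transition_jac c c' (fst (x, y)) *v axis j 1) (transition_jac c c' (fst (x, y)) *v axis k 1)
          (H (fst h) (axis l 1)))) (at (x, y))"
    unfolding x'_def
    by (intro has_derivative_trilinear_form has_derivative_pullback[OF c smT[OF c(2)] x y] dJ)
  then have "((\<lambda>z. trilinear_form
        (\<lambda>p q r. T c' p q r (transition c c' (fst z)) (transition_jac c c' (fst z) *v snd z))
        (transition_jac c c' (fst z) *v axis j 1) (transition_jac c c' (fst z) *v axis k 1)
        (transition_jac c c' (fst z) *v axis l 1)) has_derivative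
      (\<lambda>h. trilinear_form (\<lambda>p q r. total_diff (T c' p q r) x' y' (J *v fst h) (H (fst h) y + J *v snd h)) (e j) (e k) (e l)
        + trilinear_form t (H (fst h) (axis j 1)) (e k) (e l)
        + trilinear_form t (e j) (H (fst h) (axis k 1)) (e l)
        + trilinear_form t (e j) (e k) (H (fst h) (axis l 1)))) (at (x, y))"
    unfolding case_prod_unfold fst_conv snd_conv e_def t_def[abs_def] H_def J_def y'_def x'_def .
  then have "(case_prod (T c j k l) has_derivative
      (\<lambda>h. trilinear_form (\<lambda>p q r. total_diff (T c' p q r) x' y' (J *v fst h) (H (fst h) y + J *v snd h)) (e j) (e k) (e l)
        + trilinear_form t (H (fst h) (axis j 1)) (e k) (e l)
        + trilinear_form t (e j) (H (fst h) (axis k 1)) (e l)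
        + trilinear_form t (e j) (e k) (H (fst h) (axis l 1)))) (at (x, y))"
    by (rule has_derivative_transform_within_open[OF _ S z])
      (simp add: mem_Times_iff case_prod_unfold tensor_field3_transition[OF T c])
  \<comment> \<open>In this direction the pushed-forward vector is (y', -2G') by the spray law, so
    the first summand becomes \<open>s\<close>.\<close>
  from total_diff_eq[OF this, of y "- 2 *\<^sub>R spray_vec A F c x y"]
  have "total_diff (T c j k l) x y y (- 2 *\<^sub>R spray_vec A F c x y)
      = trilinear_form s (e j) (e k) (e l)
        + trilinear_form t (H y (axis j 1)) (e k) (e l)
        + trilinear_form t (e j) (H y (axis k 1)) (e l)
        + trilinear_form t (e j) (e k) (H y (axis l 1))"
    using spray_transition[OF c x y] by (simp add: s_def[abs_def] J_def H_def x'_def y'_def)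
  moreover have "H y (axis i 1) = J *v (N *v axis i 1) - N' *v e i" for i
    using nonlinear_connection_transition[OF c x y] by (simp add: J_def H_def N_def N'_def x'_def y'_def e_def)
  ultimately have lhs: "total_diff (T c j k l) x y y (- 2 *\<^sub>R spray_vec A F c x y)
      = trilinear_form s (e j) (e k) (e l)
        + (trilinear_form t (J *v (N *v axis j 1)) (e k) (e l) - trilinear_form t (N' *v e j) (e k) (e l))
        + (trilinear_form t (e j) (J *v (N *v axis k 1)) (e l) - trilinear_form t (e j) (N' *v e k) (e l))
        + (trilinear_form t (e j) (e k) (J *v (N *v axis l 1)) - trilinear_form t (e j) (e k) (N' *v e l))"
    by (simp only: linear_diff[OF linear_trilinear_form1] linear_diff[OF linear_trilinear_form2]
        linear_diff[OF linear_trilinear_form3])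
  have Tc: "T c j k l x y = trilinear_form t (e j) (e k) (e l)" for j k l
    unfolding t_def[abs_def] e_def J_def x'_def y'_def by (rule tensor_field3_transition[OF T c x y])
  \<comment> \<open>Expanding in the columns \<open>e r\<close> turns the JN terms into contractions
    of \<open>T c\<close> with \<open>N\<close>, which \<open>dynamical_deriv\<close> subtracts
    again.\<close>
  have JN: "J *v (N *v axis i 1) = (\<Sum>r\<in>UNIV. N $ r $ i *\<^sub>R e r)" for i
    by (subst matrix_vector_mult_sum_axis) (simp add: e_def matrix_vector_mult_basis column_def)
  have "dynamical_deriv T c j k l x y = trilinear_form s (e j) (e k) (e l)
      - trilinear_form t (N' *v e j) (e k) (e l) - trilinear_form t (e j) (N' *v e k) (e l)
      - trilinear_form t (e j) (e k) (N' *v e l)"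
    unfolding dynamical_deriv_def lhs JN Tc N_def[symmetric]
    by (simp add: linear_sum[OF linear_trilinear_form1] linear_scale[OF linear_trilinear_form1]
        linear_sum[OF linear_trilinear_form2] linear_scale[OF linear_trilinear_form2]
        linear_sum[OF linear_trilinear_form3] linear_scale[OF linear_trilinear_form3] mult.commute)
  also have "\<dots> = trilinear_form (\<lambda>p q r. dynamical_deriv T c' p q r x' y') (e j) (e k) (e l)"
    unfolding dynamical_deriv_def N'_def[symmetric] s_def[symmetric] t_def[symmetric] trilinear_form_diff
      trilinear_form_contract1 trilinear_form_contract2 trilinear_form_contract3 ..
  finally show ?thesis by (simp add: e_def x'_def y'_def)
qed

lemma smooth_dynamical_deriv:
  assumes T: "tensor_field3 A T" and c: "c \<in> A"
  shows "smooth_on (slit_dom c) (\<lambda>(x, y). dynamical_deriv T c j k l x y)"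
proof -
  note S = open_slit_dom[OF c]
  have smT: "smooth_on (slit_dom c) (case_prod (T c j k l))" for j k l
    using T c by (simp add: tensor_field3_def)
  have G: "smooth_on (slit_dom c) (\<lambda>(x, y). (- 2 *\<^sub>R spray_vec A F c x y) $ i)" for i
    using smooth_on_mult[OF S smooth_on_const[where c="-2"] smooth_spray[OF c, of i]]
    by (simp add: spray_vec_def case_prod_unfold)
  have N: "smooth_on (slit_dom c) (\<lambda>(x, y). nonlinear_connection A F c x y $ r $ j)" for r j
    using smooth_on_dy[OF S smooth_spray[OF c]] by (simp add: nonlinear_connection_def)
  show ?thesis
    unfolding dynamical_deriv_def case_prod_unfold
    by (intro smooth_on_minus smooth_on_sum smooth_on_mult S smT[unfolded case_prod_unfold]
        N[unfolded case_prod_unfold]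
        smooth_on_total_diff[OF S smT smooth_on_snd_nth G, unfolded case_prod_unfold])
qed

lemma tensor_field3_dynamical_deriv:
  assumes "tensor_field3 A T" shows "tensor_field3 A (dynamical_deriv T)"
  unfolding tensor_field3_def Let_def
  using smooth_dynamical_deriv[OF assms] dynamical_deriv_transition[OF assms]
  by (simp add: trilinear_form_def matrix_vector_mult_basis column_def)

text \<open>Since \<open>y\<^sup>i\<^bsub>|0\<^esub> = 0\<close>, the Berwald derivative acts on the factor \<open>T\<close> only.\<close>

lemma berwald_deriv0_coordinate:
  assumes T: "tensor_field3 A T" and c: "c \<in> A" and z: "(x, y) \<in> slit_dom c"
    and D: "\<And>x y j i k l. (x, y) \<in> slit_dom c \<Longrightarrow> D j i k l x y = T c j k l x y * y $ i"
  shows "berwald_deriv0 (G c) D j i k l x y = dynamical_deriv T c j k l x y * y $ i"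
proof -
  note S = open_slit_dom[OF c]
  have smT: "smooth_on (slit_dom c) (case_prod (T c j k l))" for j k l
    using T c by (simp add: tensor_field3_def)
  have sm: "smooth_on (slit_dom c) (case_prod (\<lambda>x y. T c j k l x y * y $ i))"
    using smooth_on_mult[OF S smT smooth_on_snd_nth] by (simp add: case_prod_unfold)
  have dD: "dx m (D j i k l) x y = dx m (T c j k l) x y * y $ i"
    "dy m (D j i k l) x y = dy m (T c j k l) x y * y $ i + T c j k l x y * axis m 1 $ i" for m
    using total_diff_cong[OF S sm z, of "D j i k l" m] D total_diff_mult_coordinate[OF smT z]
    by simp_all
  \<comment> \<open>Pulls the contraction with \<open>y\<close> inside, onto the index of the outer
    derivative, where Euler's theorem applies.\<close>
  have swap: "(\<Sum>m\<in>UNIV. (\<Sum>r\<in>UNIV. a r * dy m (f r) x y) * y $ m)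
      = (\<Sum>r\<in>UNIV. a r * (\<Sum>m\<in>UNIV. y $ m * dy m (f r) x y))" for a :: "'n \<Rightarrow> real" and f :: "'n \<Rightarrow> 'n local_fun"
    by (subst sum_distrib_right, subst sum.swap) (simp add: sum_distrib_left mult_ac)
  have E: "(\<Sum>m\<in>UNIV. (\<Sum>r\<in>UNIV. a r * dy m (G c r) x y) * y $ m) = (\<Sum>r\<in>UNIV. a r * (2 * G c r x y))" for a
    by (simp only: swap euler_spray(1)[OF c z])
  have E1: "(\<Sum>m\<in>UNIV. (\<Sum>r\<in>UNIV. a r * dy m (dy r (G c i)) x y) * y $ m) = (\<Sum>r\<in>UNIV. a r * dy r (G c i) x y)" for a
    by (simp only: swap euler_spray(2)[OF c z])
  have E2: "(\<Sum>m\<in>UNIV. (\<Sum>r\<in>UNIV. a r * dy m (dy j (G c r)) x y) * y $ m) = (\<Sum>r\<in>UNIV. a r * dy j (G c r) x y)" for a j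
    by (simp only: swap euler_spray(2)[OF c z])
  \<comment> \<open>The connection term of the contravariant index; it is balanced below by the
    vertical derivative of the factor y^i.\<close>
  have V: "(\<Sum>r\<in>UNIV. T c j k l x y * y $ r * dy r (G c i) x y) = T c j k l x y * (2 * G c i x y)"
    using euler_spray(1)[OF c z, of i] by (simp only: mult.assoc sum_distrib_left[symmetric])
  have "berwald_deriv0 (G c) D j i k l x y
      = (\<Sum>m\<in>UNIV. dx m (D j i k l) x y * y $ m)
        - (\<Sum>m\<in>UNIV. (\<Sum>r\<in>UNIV. dy r (D j i k l) x y * dy m (G c r) x y) * y $ m)
        + (\<Sum>m\<in>UNIV. (\<Sum>r\<in>UNIV. D j r k l x y * dy m (dy r (G c i)) x y) * y $ m)
        - (\<Sum>m\<in>UNIV. (\<Sum>r\<in>UNIV. D r i k l x y * dy m (dy j (G c r)) x y) * y $ m)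
        - (\<Sum>m\<in>UNIV. (\<Sum>r\<in>UNIV. D j i r l x y * dy m (dy k (G c r)) x y) * y $ m)
        - (\<Sum>m\<in>UNIV. (\<Sum>r\<in>UNIV. D j i k r x y * dy m (dy l (G c r)) x y) * y $ m)"
    unfolding berwald_deriv0_def berwald_deriv_def
    by (simp only: left_diff_distrib distrib_right sum.distrib sum_subtractf mult.commute[of "dy _ (G c _) x y" "dy _ (D j i k l) x y"])
  also have "\<dots> = (\<Sum>m\<in>UNIV. dx m (T c j k l) x y * y $ m) * y $ i
        - (\<Sum>r\<in>UNIV. (dy r (T c j k l) x y * y $ i + T c j k l x y * axis r 1 $ i) * (2 * G c r x y))
        + T c j k l x y * (2 * G c i x y)
        - (\<Sum>r\<in>UNIV. T c r k l x y * y $ i * dy j (G c r) x y)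
        - (\<Sum>r\<in>UNIV. T c j r l x y * y $ i * dy k (G c r) x y)
        - (\<Sum>r\<in>UNIV. T c j k r x y * y $ i * dy l (G c r) x y)"
    unfolding E E1 E2 dD D[OF z] V by (simp add: sum_distrib_left mult_ac)
  \<comment> \<open>The Kronecker delta from differentiating y^i leaves 2 T G^i, which cancels the
    term from \<open>V\<close>: this is the vanishing of y^i under the derivative.\<close>
  also have "(\<Sum>r\<in>UNIV. (dy r (T c j k l) x y * y $ i + T c j k l x y * axis r 1 $ i) * (2 * G c r x y))
      = (\<Sum>r\<in>UNIV. dy r (T c j k l) x y * (2 * G c r x y)) * y $ i + T c j k l x y * (2 * G c i x y)"
  proof -
    have "(\<Sum>r\<in>UNIV. T c j k l x y * axis r 1 $ i * (2 * G c r x y))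
        = (\<Sum>r\<in>UNIV. axis i 1 $ r * (T c j k l x y * (2 * G c r x y)))"
      by (rule sum.cong) (auto simp: axis_def)
    then show ?thesis
      by (simp only: sum_axis_mult distrib_right sum.distrib) (simp add: sum_distrib_left mult_ac)
  qed
  finally show ?thesis
    by (simp add: dynamical_deriv_def total_diff_def spray_vec_def nonlinear_connection_def
        sum_distrib_left sum_negf algebra_simps)
qed

end

theorem proposition4p2:
  fixes A :: "('m::{t2_space, second_countable_topology}, real^'n) chart set"
    and F :: "'m \<times> ('m, real^'n) tangent_vector \<Rightarrow> real"
  assumes "smooth_atlas A"
    and "GDW_metric A F"
  shows "W_GDW_metric A F"
proof -
  have metric: "finsler_metric A F" using assms(2) by (simp add: GDW_metric_def)
  interpret finsler_manifold A F
    by unfold_locales (fact assms(1) metric)+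
  obtain T where T: "tensor_field3 A T" and
    D: "\<And>c x y j i k l. c \<in> A \<Longrightarrow> (x, y) \<in> slit_dom c \<Longrightarrow>
      douglas_deriv0 A F c j i k l x y = T c j k l x y * y $ i"
    using assms(2) unfolding GDW_metric_def by blast
  have "smooth_scalar A (\<lambda>_. 0)"
    by (simp add: smooth_scalar_def local_rep_def case_prod_unfold smooth_on_const)
  moreover have "berwald_deriv0 (spray A F c) (douglas_deriv0 A F c) j i k l x y
      + local_rep A (\<lambda>_. 0) c x y * local_rep A F c x y * douglas_deriv0 A F c j i k l x y
      = dynamical_deriv T c j k l x y * y $ i"
    if "c \<in> A" "(x, y) \<in> slit_dom c" for c x y j i k l
    \<comment> \<open>The GDW condition is the required product form of the Douglas derivative, so
      the witness for \<open>U\<close> is \<open>dynamical_deriv T\<close>; the middle term vanishes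
      with lambda.\<close>
    using berwald_deriv0_coordinate[where D="douglas_deriv0 A F c", OF T that D[OF that(1)]]
    by (simp add: local_rep_def)
  ultimately show ?thesis
    unfolding W_GDW_metric_def using metric tensor_field3_dynamical_deriv[OF T] by blast
qed

end
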